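(* Let $A$ be a braided Hopf algebra and let $B$ be a Hopf subalgebra of $U_0(A)$ which is braided with the restriction of the braiding $(x\mid y)=\langle a\mid S(b)\rangle$ (for $x=l^+_A(a)$, $y=l^-_A(b)$) on $U_0(A)$. Define $\phi:A\to B^\circ$ by $\phi(a)(u)=u(a)$ for $a\in A$, $u\in B$. Then $\phi$ is a Hopf algebra map, and if $a\in A$ satisfies $l_A^+(a)\in B$ (resp. $l_A^-(a)\in B$) then $\phi(a)=l_B^+(l_A^+(a))$ (resp. $\phi(a)=l_B^-(l_A^-(a))$). Consequently $\phi(A)\supseteq U(B)$.
   Context: Sweedler notation $\Delta(a)=\sum a_{(1)}\otimes a_{(2)}$. A braiding on a bialgebra $A$ over a field $k$ is a bilinear form $\langle\cdot\mid\cdot\rangle:A\times A\to k$ such that for all $a,b,c\in A$: (1) $\sum\langle a_{(1)}\mid b_{(1)}\rangle\, b_{(2)}a_{(2)}=\sum\langle a_{(2)}\mid b_{(2)}\rangle\, a_{(1)}b_{(1)}$; (2) it is invertible in the convolution algebra $(A\otimes A)^*$; (3) $\langle a\mid bc\rangle=\sum\langle a_{(1)}\mid b\rangle\langle a_{(2)}\mid c\rangle$; (4) $\langle ab\mid c\rangle=\sum\langle b\mid c_{(1)}\rangle\langle a\mid c_{(2)}\rangle$. A braided Hopf algebra is a Hopf algebra with a braiding. $A^\circ$ is the restricted dual Hopf algebra. For a braided Hopf algebra $A$ with antipode $S$, $l_A^{\pm}:A\to A^\circ$ are $l_A^+(a)(b)=\langle a\mid b\rangle$, $l_A^-(a)(b)=\langle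 b\mid S(a)\rangle$. $U^\pm=l_A^\pm(A)$, $U(A)$ is the Hopf subalgebra of $A^\circ$ generated by $U^+\cup U^-$, and $U_0(A)=U^+\cap U^-$. The form $(l^+_A(a)\mid l^-_A(b))=\langle a\mid S(b)\rangle$ is a well-defined braiding on $U_0(A)$. For the braided Hopf algebra $B$, $l_B^\pm$ and $U(B)\subseteq B^\circ$ are defined in the same way using this braiding. *)

theory Defs
  imports Main
begin

text \<open>A (potential) Hopf algebra over a field 'k, given on a carrier set of
elements of type 'a. The coproduct of a is represented by a finite list of
pairs (a Sweedler sum a_(1) (x) a_(2)); two such lists represent the same
element of the tensor product iff they agree under every bilinear form
(the algebraic dual of V (x) W separates points).\<close>

record ('k, 'a) halg =
  carr :: "'a set"
  zer  :: 'a
  add  :: "'a \<Rightarrow> 'a \<Rightarrow> 'a"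
  smul :: "'k \<Rightarrow> 'a \<Rightarrow> 'a"
  mul  :: "'a \<Rightarrow> 'a \<Rightarrow> 'a"
  one  :: 'a
  cop  :: "'a \<Rightarrow> ('a \<times> 'a) list"
  cou  :: "'a \<Rightarrow> 'k"
  ant  :: "'a \<Rightarrow> 'a"

definition vsum :: "('k, 'a, 'm) halg_scheme \<Rightarrow> 'a list \<Rightarrow> 'a" where
  "vsum V xs = foldr (add V) xs (zer V)"

definition vs :: "('k::field, 'a, 'm) halg_scheme \<Rightarrow> bool" where
  "vs V \<longleftrightarrow> zer V \<in> carr V
    \<and> (\<forall>x\<in>carr V. \<forall>y\<in>carr V. add V x y \<in> carr V)
    \<and> (\<forall>c. \<forall>x\<in>carr V. smul V c x \<in> carr V)
    \<and> (\<forall>x\<in>carr V. \<forall>y\<in>carr V. \<forall>z\<in>carr V. add V (add V x y) z = add V x (add V y z))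
    \<and> (\<forall>x\<in>carr V. \<forall>y\<in>carr V. add V x y = add V y x)
    \<and> (\<forall>x\<in>carr V. add V (zer V) x = x)
    \<and> (\<forall>x\<in>carr V. add V x (smul V (-1) x) = zer V)
    \<and> (\<forall>c. \<forall>x\<in>carr V. \<forall>y\<in>carr V. smul V c (add V x y) = add V (smul V c x) (smul V c y))
    \<and> (\<forall>c d. \<forall>x\<in>carr V. smul V (c + d) x = add V (smul V c x) (smul V d x))
    \<and> (\<forall>c d. \<forall>x\<in>carr V. smul V c (smul V d x) = smul V (c * d) x)
    \<and> (\<forall>x\<in>carr V. smul V 1 x = x)"

definition lin :: "('k::field, 'a, 'm) halg_scheme \<Rightarrow> ('k, 'b, 'n) halg_scheme \<Rightarrow> ('a \<Rightarrow> 'b) \<Rightarrow> bool" where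
  "lin V W f \<longleftrightarrow> (\<forall>x\<in>carr V. f x \<in> carr W)
    \<and> (\<forall>x\<in>carr V. \<forall>y\<in>carr V. f (add V x y) = add W (f x) (f y))
    \<and> (\<forall>c. \<forall>x\<in>carr V. f (smul V c x) = smul W c (f x))"

definition lin_form :: "('k::field, 'a, 'm) halg_scheme \<Rightarrow> ('a \<Rightarrow> 'k) \<Rightarrow> bool" where
  "lin_form V f \<longleftrightarrow> (\<forall>x\<in>carr V. \<forall>y\<in>carr V. f (add V x y) = f x + f y)
    \<and> (\<forall>c. \<forall>x\<in>carr V. f (smul V c x) = c * f x)"

definition bilin :: "('k::field, 'a, 'm) halg_scheme \<Rightarrow> ('k, 'b, 'n) halg_scheme \<Rightarrow> ('a \<Rightarrow> 'b \<Rightarrow> 'k) \<Rightarrow> bool" where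
  "bilin V W \<beta> \<longleftrightarrow> (\<forall>y\<in>carr W. lin_form V (\<lambda>x. \<beta> x y)) \<and> (\<forall>x\<in>carr V. lin_form W (\<beta> x))"

definition trilin :: "('k::field, 'a, 'm) halg_scheme \<Rightarrow> ('a \<Rightarrow> 'a \<Rightarrow> 'a \<Rightarrow> 'k) \<Rightarrow> bool" where
  "trilin V \<tau> \<longleftrightarrow> (\<forall>y\<in>carr V. \<forall>z\<in>carr V. lin_form V (\<lambda>x. \<tau> x y z))
    \<and> (\<forall>x\<in>carr V. \<forall>z\<in>carr V. lin_form V (\<lambda>y. \<tau> x y z))
    \<and> (\<forall>x\<in>carr V. \<forall>y\<in>carr V. lin_form V (\<lambda>z. \<tau> x y z))"

definition tensor_eq :: "('k::field, 'a, 'm) halg_scheme \<Rightarrow> ('k, 'b, 'n) halg_scheme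
    \<Rightarrow> ('a \<times> 'b) list \<Rightarrow> ('a \<times> 'b) list \<Rightarrow> bool" where
  "tensor_eq V W xs ys \<longleftrightarrow> (\<forall>\<beta>. bilin V W \<beta> \<longrightarrow>
     sum_list (map (\<lambda>(x, y). \<beta> x y) xs) = sum_list (map (\<lambda>(x, y). \<beta> x y) ys))"

definition algebra :: "('k::field, 'a, 'm) halg_scheme \<Rightarrow> bool" where
  "algebra H \<longleftrightarrow> vs H \<and> one H \<in> carr H
    \<and> (\<forall>x\<in>carr H. \<forall>y\<in>carr H. mul H x y \<in> carr H)
    \<and> (\<forall>x\<in>carr H. \<forall>y\<in>carr H. \<forall>z\<in>carr H. mul H (add H x y) z = add H (mul H x z) (mul H y z))
    \<and> (\<forall>x\<in>carr H. \<forall>y\<in>carr H. \<forall>z\<in>carr H. mul H x (add H y z) = add H (mul H x y) (mul H x z))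
    \<and> (\<forall>c. \<forall>x\<in>carr H. \<forall>y\<in>carr H. mul H (smul H c x) y = smul H c (mul H x y))
    \<and> (\<forall>c. \<forall>x\<in>carr H. \<forall>y\<in>carr H. mul H x (smul H c y) = smul H c (mul H x y))
    \<and> (\<forall>x\<in>carr H. \<forall>y\<in>carr H. \<forall>z\<in>carr H. mul H (mul H x y) z = mul H x (mul H y z))
    \<and> (\<forall>x\<in>carr H. mul H (one H) x = x \<and> mul H x (one H) = x)"

definition coalgebra :: "('k::field, 'a, 'm) halg_scheme \<Rightarrow> bool" where
  "coalgebra H \<longleftrightarrow> vs H \<and> lin_form H (cou H)
    \<and> (\<forall>a\<in>carr H. set (cop H a) \<subseteq> carr H \<times> carr H)
    \<and> (\<forall>a\<in>carr H. \<forall>b\<in>carr H. tensor_eq H H (cop H (add H a b)) (cop H a @ cop H b))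
    \<and> (\<forall>c. \<forall>a\<in>carr H. tensor_eq H H (cop H (smul H c a))
                          (map (\<lambda>(x, y). (smul H c x, y)) (cop H a)))
    \<and> (\<forall>a\<in>carr H. \<forall>\<tau>. trilin H \<tau> \<longrightarrow>
         sum_list (map (\<lambda>(x, y). sum_list (map (\<lambda>(u, v). \<tau> u v y) (cop H x))) (cop H a))
       = sum_list (map (\<lambda>(x, y). sum_list (map (\<lambda>(u, v). \<tau> x u v) (cop H y))) (cop H a)))
    \<and> (\<forall>a\<in>carr H. vsum H (map (\<lambda>(x, y). smul H (cou H x) y) (cop H a)) = a)
    \<and> (\<forall>a\<in>carr H. vsum H (map (\<lambda>(x, y). smul H (cou H y) x) (cop H a)) = a)"

definition bialgebra :: "('k::field, 'a, 'm) halg_scheme \<Rightarrow> bool" where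
  "bialgebra H \<longleftrightarrow> algebra H \<and> coalgebra H
    \<and> (\<forall>a\<in>carr H. \<forall>b\<in>carr H. tensor_eq H H (cop H (mul H a b))
          (concat (map (\<lambda>(x, y). map (\<lambda>(u, v). (mul H x u, mul H y v)) (cop H b)) (cop H a))))
    \<and> tensor_eq H H (cop H (one H)) [(one H, one H)]
    \<and> (\<forall>a\<in>carr H. \<forall>b\<in>carr H. cou H (mul H a b) = cou H a * cou H b)
    \<and> cou H (one H) = 1"

definition hopf :: "('k::field, 'a, 'm) halg_scheme \<Rightarrow> bool" where
  "hopf H \<longleftrightarrow> bialgebra H \<and> lin H H (ant H)
    \<and> (\<forall>a\<in>carr H. vsum H (map (\<lambda>(x, y). mul H (ant H x) y) (cop H a)) = smul H (cou H a) (one H))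
    \<and> (\<forall>a\<in>carr H. vsum H (map (\<lambda>(x, y). mul H x (ant H y)) (cop H a)) = smul H (cou H a) (one H))"

text \<open>Hopf algebra map = bialgebra map between Hopf algebras.\<close>
definition hopf_map :: "('k::field, 'a, 'm) halg_scheme \<Rightarrow> ('k, 'b, 'n) halg_scheme \<Rightarrow> ('a \<Rightarrow> 'b) \<Rightarrow> bool" where
  "hopf_map H K f \<longleftrightarrow> lin H K f
    \<and> (\<forall>a\<in>carr H. \<forall>b\<in>carr H. f (mul H a b) = mul K (f a) (f b))
    \<and> f (one H) = one K
    \<and> (\<forall>a\<in>carr H. cou K (f a) = cou H a)
    \<and> (\<forall>a\<in>carr H. tensor_eq K K (map (\<lambda>(x, y). (f x, f y)) (cop H a)) (cop K (f a)))"

text \<open>Braiding (conditions (1)-(4)); invertibility in the convolution algebra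
(H (x) H)^*, whose unit is eps (x) eps.\<close>
definition is_braiding :: "('k::field, 'a, 'm) halg_scheme \<Rightarrow> ('a \<Rightarrow> 'a \<Rightarrow> 'k) \<Rightarrow> bool" where
  "is_braiding H r \<longleftrightarrow> bilin H H r
    \<and> (\<forall>a\<in>carr H. \<forall>b\<in>carr H.
         vsum H (concat (map (\<lambda>(x, y). map (\<lambda>(u, v). smul H (r x u) (mul H v y)) (cop H b)) (cop H a)))
       = vsum H (concat (map (\<lambda>(x, y). map (\<lambda>(u, v). smul H (r y v) (mul H x u)) (cop H b)) (cop H a))))
    \<and> (\<exists>r'. bilin H H r' \<and>
         (\<forall>a\<in>carr H. \<forall>b\<in>carr H.
            sum_list (concat (map (\<lambda>(x, y). map (\<lambda>(u, v). r x u * r' y v) (cop H b)) (cop H a)))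
              = cou H a * cou H b
          \<and> sum_list (concat (map (\<lambda>(x, y). map (\<lambda>(u, v). r' x u * r y v) (cop H b)) (cop H a)))
              = cou H a * cou H b))
    \<and> (\<forall>a\<in>carr H. \<forall>b\<in>carr H. \<forall>c\<in>carr H.
         r a (mul H b c) = sum_list (map (\<lambda>(x, y). r x b * r y c) (cop H a)))
    \<and> (\<forall>a\<in>carr H. \<forall>b\<in>carr H. \<forall>c\<in>carr H.
         r (mul H a b) c = sum_list (map (\<lambda>(u, v). r b u * r a v) (cop H c)))"

text \<open>Restricted dual H^o. Functionals are represented extensionally (zero off the carrier).\<close>
definition ideal :: "('k::field, 'a, 'm) halg_scheme \<Rightarrow> 'a set \<Rightarrow> bool" where
  "ideal H I \<longleftrightarrow> I \<subseteq> carr H \<and> zer H \<in> I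
    \<and> (\<forall>x\<in>I. \<forall>y\<in>I. add H x y \<in> I) \<and> (\<forall>c. \<forall>x\<in>I. smul H c x \<in> I)
    \<and> (\<forall>x\<in>I. \<forall>y\<in>carr H. mul H x y \<in> I \<and> mul H y x \<in> I)"

definition span :: "('k::field, 'a, 'm) halg_scheme \<Rightarrow> 'a set \<Rightarrow> 'a set" where
  "span H S = {vsum H (map (\<lambda>(c, v). smul H c v) cvs) | cvs. set (map snd cvs) \<subseteq> S}"

definition cofinite :: "('k::field, 'a, 'm) halg_scheme \<Rightarrow> 'a set \<Rightarrow> bool" where
  "cofinite H I \<longleftrightarrow> (\<exists>F. finite F \<and> F \<subseteq> carr H \<and>
      (\<forall>x\<in>carr H. \<exists>s\<in>span H F. \<exists>i\<in>I. x = add H s i))"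

definition rdual_carr :: "('k::field, 'a, 'm) halg_scheme \<Rightarrow> ('a \<Rightarrow> 'k) set" where
  "rdual_carr H = {f. lin_form H f \<and> (\<forall>x. x \<notin> carr H \<longrightarrow> f x = 0)
      \<and> (\<exists>I. ideal H I \<and> cofinite H I \<and> (\<forall>x\<in>I. f x = 0))}"

definition rdual :: "('k::field, 'a, 'm) halg_scheme \<Rightarrow> ('k, 'a \<Rightarrow> 'k) halg" where
  "rdual H = \<lparr> carr = rdual_carr H,
     zer = (\<lambda>x. 0),
     add = (\<lambda>f g x. f x + g x),
     smul = (\<lambda>c f x. c * f x),
     mul = (\<lambda>f g x. if x \<in> carr H then sum_list (map (\<lambda>(y, z). f y * g z) (cop H x)) else 0),
     one = (\<lambda>x. if x \<in> carr H then cou H x else 0),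
     cop = (\<lambda>f. SOME xs. set xs \<subseteq> rdual_carr H \<times> rdual_carr H \<and>
              (\<forall>x\<in>carr H. \<forall>y\<in>carr H. f (mul H x y) = sum_list (map (\<lambda>(g, h). g x * h y) xs))),
     cou = (\<lambda>f. f (one H)),
     ant = (\<lambda>f x. if x \<in> carr H then f (ant H x) else 0) \<rparr>"

definition sub_hopf :: "('k::field, 'a, 'm) halg_scheme \<Rightarrow> 'a set \<Rightarrow> bool" where
  "sub_hopf H B \<longleftrightarrow> B \<subseteq> carr H \<and> zer H \<in> B \<and> one H \<in> B
    \<and> (\<forall>x\<in>B. \<forall>y\<in>B. add H x y \<in> B \<and> mul H x y \<in> B)
    \<and> (\<forall>c. \<forall>x\<in>B. smul H c x \<in> B) \<and> (\<forall>x\<in>B. ant H x \<in> B)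
    \<and> (\<forall>u\<in>B. \<exists>xs. set xs \<subseteq> B \<times> B \<and> tensor_eq H H xs (cop H u))"

definition subhalg :: "('k::field, 'a, 'm) halg_scheme \<Rightarrow> 'a set \<Rightarrow> ('k, 'a, 'm) halg_scheme" where
  "subhalg H B = H\<lparr> carr := B,
      cop := (\<lambda>u. SOME xs. set xs \<subseteq> B \<times> B \<and> tensor_eq H H xs (cop H u)) \<rparr>"

definition gen_hopf :: "('k::field, 'a, 'm) halg_scheme \<Rightarrow> 'a set \<Rightarrow> 'a set" where
  "gen_hopf H S = \<Inter>{B. sub_hopf H B \<and> S \<subseteq> B}"

definition lp :: "('k::field, 'a, 'm) halg_scheme \<Rightarrow> ('a \<Rightarrow> 'a \<Rightarrow> 'k) \<Rightarrow> 'a \<Rightarrow> ('a \<Rightarrow> 'k)" where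
  "lp H r a = (\<lambda>b. if b \<in> carr H then r a b else 0)"

definition lm :: "('k::field, 'a, 'm) halg_scheme \<Rightarrow> ('a \<Rightarrow> 'a \<Rightarrow> 'k) \<Rightarrow> 'a \<Rightarrow> ('a \<Rightarrow> 'k)" where
  "lm H r a = (\<lambda>b. if b \<in> carr H then r b (ant H a) else 0)"

definition U0 :: "('k::field, 'a, 'm) halg_scheme \<Rightarrow> ('a \<Rightarrow> 'a \<Rightarrow> 'k) \<Rightarrow> ('a \<Rightarrow> 'k) set" where
  "U0 H r = lp H r ` carr H \<inter> lm H r ` carr H"

text \<open>The braiding (l^+(a) | l^-(b)) = <a | S(b)> on U_0 (well defined by the paper).\<close>
definition brU :: "('k::field, 'a, 'm) halg_scheme \<Rightarrow> ('a \<Rightarrow> 'a \<Rightarrow> 'k) \<Rightarrow> ('a \<Rightarrow> 'k) \<Rightarrow> ('a \<Rightarrow> 'k) \<Rightarrow> 'k" where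
  "brU H r x y = r (SOME a. a \<in> carr H \<and> lp H r a = x) (ant H (SOME b. b \<in> carr H \<and> lm H r b = y))"

definition phi :: "('a \<Rightarrow> 'k::field) set \<Rightarrow> 'a \<Rightarrow> (('a \<Rightarrow> 'k) \<Rightarrow> 'k)" where
  "phi B a = (\<lambda>u. if u \<in> B then u a else 0)"

end

theory Submission
  imports Defs
begin

text \<open>
  Evaluation at \<open>a\<close> satisfies \<open>(u v)(a) = \<Sum> u(a\<^sub>1) v(a\<^sub>2)\<close>, so it has finite rank on \<open>B\<close> and lies in the
  restricted dual; that \<open>\<phi>\<close> respects all structure maps is then duality. Coproducts in a restricted
  dual are only determined by their evaluations, and these determine the tensor because
  \<open>V\<^sup>* \<otimes> V\<^sup>* \<rightarrow> (V \<otimes> V)\<^sup>*\<close> is injective. If \<open>u = l\<^sup>-(b)\<close> then \<open>(l\<^sup>+(a) | u) = \<langle>a | S b\<rangle> = u(a)\<close>, which is the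
  formula for \<open>l\<^sup>+\<close>. The formula for \<open>l\<^sup>-\<close> reduces in the same way to \<open>\<langle>S c | S a\<rangle> = \<langle>c | a\<rangle>\<close>:
  in the convolution algebra \<open>\<langle>c | S a\<rangle>\<close> is a right inverse of \<open>\<langle>c | a\<rangle>\<close>, and \<open>\<langle>S c | S a\<rangle>\<close> is a
  right inverse of \<open>\<langle>c | S a\<rangle>\<close>. Finally, the image of \<open>\<phi>\<close> is a Hopf subalgebra containing the
  generators of \<open>U(B)\<close>.
\<close>

section \<open>Sweedler sums as scalars\<close>

text \<open>Coproduct lists represent tensors only up to evaluation by bilinear forms. Sweedler sums
  are therefore kept scalar: \<open>F\<close> is the test form, and identities in \<open>H\<close>
  are used after a functional has been applied.\<close>

definition sw :: "('k::field, 'a, 'm) halg_scheme \<Rightarrow> 'a \<Rightarrow> ('a \<Rightarrow> 'a \<Rightarrow> 'k) \<Rightarrow> 'k" where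
  "sw H a F = sum_list (map (\<lambda>(x, y). F x y) (cop H a))"

lemma sum_list_concat_map:
  "sum_list (concat (map f xs)) = (\<Sum>x\<leftarrow>xs. sum_list (f x :: 'k::comm_monoid_add list))"
  by (induction xs) auto

lemma sw_sw_eq_concat:
  "sum_list (concat (map (\<lambda>(x, y). map (\<lambda>(u, v). F x y u v) (cop H b)) (cop H a)))
    = sw H a (\<lambda>x y. sw H b (F x y))"
  by (simp add: sum_list_concat_map sw_def case_prod_unfold comp_def)

lemma sw_mult_left: "sw H a (\<lambda>x y. c * F x y) = c * sw H a F"
  by (simp add: sw_def case_prod_unfold sum_list_const_mult)

lemma sw_mult_right: "sw H a (\<lambda>x y. F x y * c) = sw H a F * c"
  by (simp add: sw_def case_prod_unfold sum_list_mult_const)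

lemma sum_list_swap:
  "(\<Sum>x\<leftarrow>xs. \<Sum>y\<leftarrow>ys. f x y :: 'k::comm_monoid_add) = (\<Sum>y\<leftarrow>ys. \<Sum>x\<leftarrow>xs. f x y)"
  by (induction xs) (auto simp: sum_list_addf)

lemma sw_swap:
  "sw H a (\<lambda>x y. sw H' b (\<lambda>u v. F x y u v)) = sw H' b (\<lambda>u v. sw H a (\<lambda>x y. F x y u v))"
  unfolding sw_def case_prod_unfold by (rule sum_list_swap)

section \<open>Multilinearity\<close>

lemma vs_closed:
  assumes "vs V"
  shows "zer V \<in> carr V" "\<And>x y. x \<in> carr V \<Longrightarrow> y \<in> carr V \<Longrightarrow> add V x y \<in> carr V"
    "\<And>c x. x \<in> carr V \<Longrightarrow> smul V c x \<in> carr V"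
  using assms by (simp_all add: vs_def)

lemma lin_form_zer: "vs V \<Longrightarrow> lin_form V f \<Longrightarrow> f (zer V) = 0"
proof -
  assume V: "vs V" and f: "lin_form V f"
  have z: "zer V \<in> carr V" "add V (zer V) (zer V) = zer V" using V by (auto simp: vs_def)
  then have "f (zer V) + f (zer V) = f (zer V)" using f by (metis lin_form_def)
  then show ?thesis by (metis add_cancel_right_right)
qed

lemma vsum_closed: "vs V \<Longrightarrow> set xs \<subseteq> carr V \<Longrightarrow> vsum V xs \<in> carr V"
  by (induction xs) (auto simp: vsum_def vs_closed)

lemma lin_form_vsum:
  assumes "vs V" "lin_form V f" "set xs \<subseteq> carr V"
  shows "f (vsum V xs) = sum_list (map f xs)"
  using assms(3)
proof (induction xs)
  case Nil
  then show ?case using lin_form_zer[OF assms(1,2)] by (simp add: vsum_def)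
next
  case (Cons x xs)
  then have "vsum V xs \<in> carr V" using vsum_closed[OF assms(1)] by simp
  moreover have "vsum V (x # xs) = add V x (vsum V xs)" by (simp add: vsum_def)
  ultimately show ?case using Cons assms(2) by (simp add: lin_form_def)
qed

lemma lin_form_mult_left: "lin_form V f \<Longrightarrow> lin_form V (\<lambda>x. c * f x)"
  by (simp add: lin_form_def algebra_simps)

lemma lin_form_mult_right: "lin_form V f \<Longrightarrow> lin_form V (\<lambda>x. f x * c)"
  by (simp add: lin_form_def algebra_simps)

lemma lin_form_sum_list:
  assumes "\<And>p. p \<in> set xs \<Longrightarrow> lin_form V (f p)"
  shows "lin_form V (\<lambda>x. \<Sum>p\<leftarrow>xs. f p x)"
  using assms by (induction xs) (auto simp: lin_form_def algebra_simps)

lemma lin_form_comp: "lin_form W f \<Longrightarrow> lin V W g \<Longrightarrow> lin_form V (\<lambda>x. f (g x))"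
  by (simp add: lin_form_def lin_def)

lemma lin_form_bilin_left: "bilin V W \<beta> \<Longrightarrow> lin U V g \<Longrightarrow> y \<in> carr W \<Longrightarrow> lin_form U (\<lambda>x. \<beta> (g x) y)"
  by (simp add: bilin_def lin_form_def lin_def)

lemma lin_form_bilin_right: "bilin V W \<beta> \<Longrightarrow> lin U W g \<Longrightarrow> x \<in> carr V \<Longrightarrow> lin_form U (\<lambda>y. \<beta> x (g y))"
  by (simp add: bilin_def lin_form_def lin_def)

lemma bilinI:
  "(\<And>y. y \<in> carr W \<Longrightarrow> lin_form V (\<lambda>x. \<beta> x y)) \<Longrightarrow> (\<And>x. x \<in> carr V \<Longrightarrow> lin_form W (\<lambda>y. \<beta> x y))
    \<Longrightarrow> bilin V W \<beta>"
  by (simp add: bilin_def)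

lemma trilinI:
  "(\<And>y z. y \<in> carr V \<Longrightarrow> z \<in> carr V \<Longrightarrow> lin_form V (\<lambda>x. \<tau> x y z)) \<Longrightarrow>
   (\<And>x z. x \<in> carr V \<Longrightarrow> z \<in> carr V \<Longrightarrow> lin_form V (\<lambda>y. \<tau> x y z)) \<Longrightarrow>
   (\<And>x y. x \<in> carr V \<Longrightarrow> y \<in> carr V \<Longrightarrow> lin_form V (\<lambda>z. \<tau> x y z)) \<Longrightarrow> trilin V \<tau>"
  by (simp add: trilin_def)

lemma lin_ident: "lin V V (\<lambda>x. x)"
  by (simp add: lin_def)

section \<open>Subspaces of finite codimension\<close>

definition subsp :: "('k::field, 'a, 'm) halg_scheme \<Rightarrow> 'a set \<Rightarrow> bool" where
  "subsp V W \<longleftrightarrow> W \<subseteq> carr V \<and> zer V \<in> W \<and> (\<forall>x\<in>W. \<forall>y\<in>W. add V x y \<in> W)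
    \<and> (\<forall>c. \<forall>x\<in>W. smul V c x \<in> W)"

lemma ideal_subsp: "ideal H I \<Longrightarrow> subsp H I"
  by (simp add: ideal_def subsp_def)

locale vspace =
  fixes V :: "('k::field, 'a, 'm) halg_scheme"
  assumes vs: "vs V"
begin

lemmas closed = vs_closed[OF vs]

lemma add_assoc:
  "x \<in> carr V \<Longrightarrow> y \<in> carr V \<Longrightarrow> z \<in> carr V \<Longrightarrow> add V (add V x y) z = add V x (add V y z)"
  using vs unfolding vs_def by blast

lemma add_comm: "x \<in> carr V \<Longrightarrow> y \<in> carr V \<Longrightarrow> add V x y = add V y x"
  using vs unfolding vs_def by blast

lemma add_lcomm:
  "x \<in> carr V \<Longrightarrow> y \<in> carr V \<Longrightarrow> z \<in> carr V \<Longrightarrow> add V x (add V y z) = add V y (add V x z)"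
  by (metis add_assoc add_comm)

lemmas add_ac = add_assoc add_comm add_lcomm

lemma add_zer: "x \<in> carr V \<Longrightarrow> add V (zer V) x = x"
  using vs unfolding vs_def by blast

lemma smul_add_right:
  "x \<in> carr V \<Longrightarrow> y \<in> carr V \<Longrightarrow> smul V c (add V x y) = add V (smul V c x) (smul V c y)"
  using vs unfolding vs_def by blast

lemma smul_add_left: "x \<in> carr V \<Longrightarrow> smul V (c + d) x = add V (smul V c x) (smul V d x)"
  using vs unfolding vs_def by blast

lemma smul_smul: "x \<in> carr V \<Longrightarrow> smul V c (smul V d x) = smul V (c * d) x"
  using vs unfolding vs_def by blast

lemma smul_zero: "x \<in> carr V \<Longrightarrow> smul V 0 x = zer V"
proof -
  assume x: "x \<in> carr V"
  have "add V x (smul V (- 1) x) = zer V" "smul V 1 x = x"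
    using x vs unfolding vs_def by blast+
  then show ?thesis using smul_add_left[OF x, of 1 "-1"] by simp
qed

lemma add_smul_cancel: "x \<in> carr V \<Longrightarrow> add V (smul V c x) (smul V (- c) x) = zer V"
  using smul_add_left[of x c "- c"] smul_zero by simp

lemma span_empty: "span V {} = {zer V}"
  by (auto simp: span_def vsum_def)

lemma span_step:
  assumes "s \<in> span V F" "e \<in> F'" "F \<subseteq> F'"
  shows "add V (smul V c e) s \<in> span V F'"
proof -
  obtain cvs where cvs: "s = vsum V (map (\<lambda>(c, v). smul V c v) cvs)" "set (map snd cvs) \<subseteq> F"
    using assms(1) by (auto simp: span_def)
  have "add V (smul V c e) s = vsum V (map (\<lambda>(c, v). smul V c v) ((c, e) # cvs))"
    by (simp add: cvs(1) vsum_def)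
  moreover have "set (map snd ((c, e) # cvs)) \<subseteq> F'" using cvs(2) assms by auto
  ultimately show ?thesis unfolding span_def by blast
qed

lemma span_induct [consumes 1, case_names zer step]:
  assumes "s \<in> span V F" and "P (zer V)"
    and "\<And>c e t. e \<in> F \<Longrightarrow> t \<in> span V F \<Longrightarrow> P t \<Longrightarrow> P (add V (smul V c e) t)"
  shows "P s"
proof -
  obtain cvs where cvs: "s = vsum V (map (\<lambda>(c, v). smul V c v) cvs)" "set (map snd cvs) \<subseteq> F"
    using assms(1) by (auto simp: span_def)
  have "P (vsum V (map (\<lambda>(c, v). smul V c v) cvs))"
    using cvs(2)
  proof (induction cvs)
    case Nil
    then show ?case using assms(2) by (simp add: vsum_def)
  next
    case (Cons p cvs)
    obtain c e where p: "p = (c, e)" by (cases p)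
    have "vsum V (map (\<lambda>(c, v). smul V c v) cvs) \<in> span V F"
      using Cons.prems by (auto simp: span_def)
    then show ?case using Cons assms(3) p by (simp add: vsum_def)
  qed
  then show ?thesis using cvs(1) by simp
qed

lemma span_closed: "s \<in> span V F \<Longrightarrow> F \<subseteq> carr V \<Longrightarrow> s \<in> carr V"
  by (induction rule: span_induct) (auto simp: closed)

lemma span_zer: "zer V \<in> span V F"
  by (auto simp: span_def vsum_def intro!: exI[of _ "[]"])

lemma span_mono: "s \<in> span V F \<Longrightarrow> F \<subseteq> G \<Longrightarrow> s \<in> span V G"
  by (auto simp: span_def)

lemma span_add:
  assumes "F \<subseteq> carr V" "s \<in> span V F" "t \<in> span V F"
  shows "add V s t \<in> span V F"
  using assms(2)
proof (induction rule: span_induct)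
  case zer
  then show ?case using add_zer span_closed assms by simp
next
  case (step c e u)
  have "add V (add V (smul V c e) u) t = add V (smul V c e) (add V u t)"
    using step span_closed assms by (intro add_assoc closed) auto
  then show ?case using span_step[OF step.IH step.hyps(1)] by simp
qed

lemma span_insert:
  assumes "s \<in> span V (insert e F)" "insert e F \<subseteq> carr V"
  shows "\<exists>t\<in>span V F. \<exists>c. s = add V t (smul V c e)"
  using assms(1)
proof (induction rule: span_induct)
  case zer
  have "zer V = add V (zer V) (smul V 0 e)" using assms(2) by (simp add: smul_zero add_zer closed)
  then show ?case using span_zer by blast
next
  case (step c f u)
  then obtain t d where t: "t \<in> span V F" "u = add V t (smul V d e)" by blast
  have C: "t \<in> carr V" "e \<in> carr V" "f \<in> carr V" using t span_closed assms step by auto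
  show ?case
  proof (cases "f = e")
    case True
    have "add V (smul V c f) u = add V t (smul V (c + d) e)"
      using C by (simp add: True t(2) smul_add_left add_ac closed)
    then show ?thesis using t(1) by blast
  next
    case False
    then have "f \<in> F" using step.hyps by simp
    moreover have "add V (smul V c f) u = add V (add V (smul V c f) t) (smul V d e)"
      using C by (simp add: t(2) add_assoc closed)
    ultimately show ?thesis using span_step[OF t(1)] by blast
  qed
qed

text \<open>If \<open>J\<close> has finite codimension in \<open>V\<close>, then
  \<open>W \<inter> J\<close> has finite codimension in \<open>W\<close>. The induction moves one
  vector of \<open>F\<close> at a time into \<open>J\<close>; each such move changes the
  intersection with \<open>W\<close> by at most one dimension.\<close>

lemma finite_codim_Int:
  assumes "finite F" "F \<subseteq> carr V" "subsp V J" and W: "subsp V W"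
    and "\<forall>x\<in>carr V. \<exists>s\<in>span V F. \<exists>j\<in>J. x = add V s j"
  shows "\<exists>G. finite G \<and> G \<subseteq> W \<and> (\<forall>w\<in>W. \<exists>s\<in>span V G. \<exists>j\<in>W \<inter> J. w = add V s j)"
  using assms(1,2,3,5)
proof (induction F arbitrary: J rule: finite_induct)
  case empty
  have "w \<in> J" if "w \<in> W" for w
  proof -
    have "w \<in> carr V" using that W by (auto simp: subsp_def)
    then obtain j where "j \<in> J" "w = add V (zer V) j" using empty by (auto simp: span_empty)
    then show ?thesis using add_zer empty.prems(2) by (metis in_mono subsp_def)
  qed
  moreover have "w = add V (zer V) w" if "w \<in> W" for w
    using that W add_zer by (auto simp: subsp_def)
  ultimately show ?case using span_zer by (intro exI[of _ "{}"]) blast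
next
  case (insert e F)
  \<comment> \<open>\<open>J'\<close> is \<open>J\<close> plus the line through \<open>e\<close>, so
    the smaller set \<open>F\<close> already spans \<open>V\<close> modulo \<open>J'\<close> and the
    induction hypothesis applies.\<close>
  define J' where "J' = {add V j (smul V c e) | j c. j \<in> J}"
  have e: "e \<in> carr V" using insert.prems by simp
  have J: "\<And>j. j \<in> J \<Longrightarrow> j \<in> carr V" "zer V \<in> J" "\<And>x y. x \<in> J \<Longrightarrow> y \<in> J \<Longrightarrow> add V x y \<in> J"
    "\<And>c x. x \<in> J \<Longrightarrow> smul V c x \<in> J"
    using insert.prems(2) by (auto simp: subsp_def)
  have WC: "\<And>w. w \<in> W \<Longrightarrow> w \<in> carr V" "\<And>x y. x \<in> W \<Longrightarrow> y \<in> W \<Longrightarrow> add V x y \<in> W"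
    "\<And>c x. x \<in> W \<Longrightarrow> smul V c x \<in> W"
    using W by (auto simp: subsp_def)
  have "subsp V J'"
    unfolding subsp_def
  proof (intro conjI ballI allI)
    show "J' \<subseteq> carr V" using J e by (auto simp: J'_def closed)
    have "zer V = add V (zer V) (smul V 0 e)" using e by (simp add: smul_zero add_zer closed)
    then show "zer V \<in> J'" unfolding J'_def using J(2) by blast
  next
    fix x y assume "x \<in> J'" "y \<in> J'"
    then obtain i c j d where "i \<in> J" "j \<in> J" "x = add V i (smul V c e)" "y = add V j (smul V d e)"
      unfolding J'_def by blast
    moreover from this have "add V x y = add V (add V i j) (smul V (c + d) e)"
      using e J by (simp add: smul_add_left add_ac closed)
    ultimately show "add V x y \<in> J'" unfolding J'_def using J(3) by blast
  next
    fix x c assume "x \<in> J'"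
    then obtain i d where "i \<in> J" "x = add V i (smul V d e)"
      unfolding J'_def by blast
    moreover from this have "smul V c x = add V (smul V c i) (smul V (c * d) e)"
      using e J by (simp add: smul_add_right smul_smul closed)
    ultimately show "smul V c x \<in> J'" unfolding J'_def using J(4) by blast
  qed
  moreover have "\<forall>x\<in>carr V. \<exists>s\<in>span V F. \<exists>j\<in>J'. x = add V s j"
  proof
    fix x assume "x \<in> carr V"
    then obtain s j where s: "s \<in> span V (insert e F)" and j: "j \<in> J" "x = add V s j"
      using insert.prems by blast
    obtain t c where t: "t \<in> span V F" "s = add V t (smul V c e)"
      using span_insert[OF s] insert.prems by blast
    have "t \<in> carr V" using t(1) span_closed insert.prems by simp
    then have "x = add V t (add V j (smul V c e))"
      using e j J by (simp add: t(2) add_ac closed)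
    then show "\<exists>s\<in>span V F. \<exists>j\<in>J'. x = add V s j" unfolding J'_def using t(1) j(1) by blast
  qed
  ultimately obtain G where G: "finite G" "G \<subseteq> W"
    and dec: "\<forall>w\<in>W. \<exists>s\<in>span V G. \<exists>j\<in>W \<inter> J'. w = add V s j"
    using insert.IH[of J'] insert.prems(1) by auto
  show ?case
  proof (cases "W \<inter> J' \<subseteq> J")
    case True
    then show ?thesis using G dec by (intro exI[of _ G]) blast
  next
    case False
    \<comment> \<open>A single extra generator is enough: \<open>w0\<close> has a nonzero
      \<open>e\<close>-coefficient \<open>c0\<close>, so multiples of it can remove the
      \<open>e\<close>-part of every member of \<open>W \<inter> J'\<close>.\<close>
    then obtain w0 j0 c0 where w0: "w0 \<in> W" "w0 \<notin> J" and j0: "j0 \<in> J" "w0 = add V j0 (smul V c0 e)"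
      unfolding J'_def by blast
    have c0: "c0 \<noteq> 0"
    proof
      assume "c0 = 0"
      then have "w0 = j0" using j0 e J by (simp add: smul_zero add_zer add_comm[of j0] closed)
      then show False using w0 j0 by simp
    qed
    have "\<exists>s\<in>span V (insert w0 G). \<exists>j\<in>W \<inter> J. w = add V s j" if "w \<in> W" for w
    proof -
      from dec that obtain s x where s: "s \<in> span V G" and x: "x \<in> W" "x \<in> J'" "w = add V s x"
        by blast
      from x(2) obtain j c where j: "j \<in> J" "x = add V j (smul V c e)"
        unfolding J'_def by blast
      \<comment> \<open>With this \<open>d\<close> the \<open>e\<close>-parts of \<open>x\<close>
        and \<open>d\<close> times \<open>w0\<close> agree, so their difference \<open>y\<close>
        falls into \<open>J\<close> while staying in \<open>W\<close>.\<close>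
      define d where "d = c / c0"
      define y where "y = add V x (smul V (- d) w0)"
      have C: "s \<in> carr V" "j \<in> carr V" "j0 \<in> carr V" "w0 \<in> carr V" "x \<in> carr V"
        using s span_closed G WC J j j0 w0 x by blast+
      have "y = add V (add V j (smul V (- d) j0)) (add V (smul V c e) (smul V (- c) e))"
        unfolding y_def using C c0 e
        by (simp add: j j0 smul_add_right smul_smul add_ac closed d_def)
      also have "\<dots> = add V j (smul V (- d) j0)"
        using C e by (simp add: add_smul_cancel add_zer add_comm[of _ "zer V"] closed)
      finally have "y \<in> J" using j j0 J by simp
      moreover have "y \<in> W" using x w0 WC by (simp add: y_def)
      moreover have "w = add V (add V (smul V d w0) s) y"
      proof -
        have "add V (add V (smul V d w0) s) y
            = add V (add V (smul V d w0) (smul V (- d) w0)) (add V s x)"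
          unfolding y_def using C by (simp add: add_ac closed)
        then show ?thesis using C x(3) by (simp add: add_smul_cancel add_zer closed)
      qed
      moreover have "add V (smul V d w0) s \<in> span V (insert w0 G)"
        using s by (intro span_step) auto
      ultimately show ?thesis by blast
    qed
    then show ?thesis using G w0 by (intro exI[of _ "insert w0 G"]) auto
  qed
qed

text \<open>Codimensions add up along \<open>I \<inter> J\<close>, \<open>I\<close>,
  \<open>V\<close>: generators of \<open>V\<close> modulo \<open>I\<close> together with generators
  of \<open>I\<close> modulo \<open>I \<inter> J\<close> do the job. This is what makes the
  restricted dual closed under addition.\<close>

lemma cofinite_Int:
  assumes "cofinite V I" "cofinite V J" "subsp V I" "subsp V J"
  shows "cofinite V (I \<inter> J)"
proof -
  obtain F where F: "finite F" "F \<subseteq> carr V"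
    and decF: "\<forall>x\<in>carr V. \<exists>s\<in>span V F. \<exists>i\<in>I. x = add V s i"
    using assms(1) by (auto simp: cofinite_def)
  obtain F' where F': "finite F'" "F' \<subseteq> carr V" "\<forall>x\<in>carr V. \<exists>s\<in>span V F'. \<exists>j\<in>J. x = add V s j"
    using assms(2) by (auto simp: cofinite_def)
  obtain G where G: "finite G" "G \<subseteq> I"
    and decG: "\<forall>w\<in>I. \<exists>s\<in>span V G. \<exists>j\<in>I \<inter> J. w = add V s j"
    using finite_codim_Int[OF F'(1,2) assms(4,3) F'(3)] by blast
  have sub: "I \<subseteq> carr V" using assms(3) by (simp add: subsp_def)
  have FG: "F \<union> G \<subseteq> carr V" using F G sub by blast
  have "\<exists>s\<in>span V (F \<union> G). \<exists>i\<in>I \<inter> J. x = add V s i" if x: "x \<in> carr V" for x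
  proof -
    obtain s i where s: "s \<in> span V F" "i \<in> I" "x = add V s i" using decF x by blast
    obtain t j where t: "t \<in> span V G" "j \<in> I \<inter> J" "i = add V t j" using decG s(2) by blast
    have st: "s \<in> span V (F \<union> G)" "t \<in> span V (F \<union> G)"
      using s(1) t(1) by (auto intro: span_mono)
    then have "x = add V (add V s t) j"
      using s(3) t(2,3) sub span_closed[OF _ FG] by (auto simp: add_assoc)
    then show ?thesis using span_add[OF FG st] t(2) by blast
  qed
  then show ?thesis unfolding cofinite_def using F G FG by (intro exI[of _ "F \<union> G"]) auto
qed

end

text \<open>A further functional either vanishes on the joint kernel of the previous ones, and
  nothing changes, or is nonzero at some \<open>e\<close> in that kernel, and then \<open>e\<close>
  is the one new generator.\<close>

lemma finite_codim_joint_kernel: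
  assumes V: "vs V" and "\<And>h. h \<in> set hs \<Longrightarrow> lin_form V h"
  shows "\<exists>F. finite F \<and> F \<subseteq> carr V \<and>
    (\<forall>x\<in>carr V. \<exists>s\<in>span V F. \<exists>i\<in>carr V. (\<forall>h\<in>set hs. h i = 0) \<and> x = add V s i)"
proof -
  interpret vspace V by unfold_locales (rule V)
  show ?thesis
    using assms(2)
  proof (induction hs)
    case Nil
    have "zer V \<in> span V {}" by (auto simp: span_def vsum_def)
    moreover have "\<And>x. x \<in> carr V \<Longrightarrow> x = add V (zer V) x" using V unfolding vs_def by metis
    ultimately show ?case by (intro exI[of _ "{}"]) auto
  next
    case (Cons h hs)
    then obtain F where F: "finite F" "F \<subseteq> carr V"
      and dec: "\<And>x. x \<in> carr V \<Longrightarrow> \<exists>s\<in>span V F. \<exists>i\<in>carr V. (\<forall>h\<in>set hs. h i = 0) \<and> x = add V s i"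
      by auto
    show ?case
    proof (cases "\<forall>i\<in>carr V. (\<forall>h\<in>set hs. h i = 0) \<longrightarrow> h i = 0")
      case True
      show ?thesis
      proof (intro exI[of _ F] conjI F ballI)
        fix x assume "x \<in> carr V"
        then obtain s i where "s \<in> span V F" "i \<in> carr V" "\<forall>h\<in>set hs. h i = 0" "x = add V s i"
          using dec by blast
        then show "\<exists>s\<in>span V F. \<exists>i\<in>carr V. (\<forall>h\<in>set (h # hs). h i = 0) \<and> x = add V s i"
          using True by (intro bexI[of _ s] bexI[of _ i]) auto
      qed
    next
      case False
      then obtain e where e: "e \<in> carr V" "\<forall>h\<in>set hs. h e = 0" "h e \<noteq> 0" by auto
      have "\<exists>s\<in>span V (insert e F). \<exists>i\<in>carr V. (\<forall>h\<in>set (h # hs). h i = 0) \<and> x = add V s i"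
        if x: "x \<in> carr V" for x
      proof -
        from dec[OF x] obtain s i where s: "s \<in> span V F" and i: "i \<in> carr V" "\<forall>h\<in>set hs. h i = 0"
          and xs: "x = add V s i" by blast
        have sC: "s \<in> carr V" using span_closed[OF s F(2)] .
        \<comment> \<open>The multiple of \<open>e\<close> that corrects \<open>i\<close> into the
          kernel of \<open>h\<close>; the other functionals do not notice, since they vanish at
          \<open>e\<close>.\<close>
        define c where "c = h i / h e"
        define s' where "s' = add V (smul V c e) s"
        define i' where "i' = add V i (smul V (- c) e)"
        have ceC: "smul V c e \<in> carr V" "smul V (- c) e \<in> carr V" using V e by (auto simp: vs_closed)
        have s'S: "s' \<in> span V (insert e F)" unfolding s'_def using s by (intro span_step) auto
        have i'C: "i' \<in> carr V" using V i ceC by (auto simp: i'_def vs_closed)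
        have lf: "g i' = g i - c * g e" if "g \<in> set (h # hs)" for g
          using Cons.prems[OF that] i(1) e(1) ceC by (simp add: i'_def lin_form_def)
        have i'0: "\<forall>g\<in>set (h # hs). g i' = 0"
        proof
          fix g assume g: "g \<in> set (h # hs)"
          show "g i' = 0"
          proof (cases "g = h")
            case True
            then show ?thesis using lf[OF g] e(3) by (simp add: c_def)
          next
            case False
            then have "g \<in> set hs" using g by simp
            then show ?thesis using lf[OF g] i(2) e(2) by fastforce
          qed
        qed
        have "add V s' i' = add V (add V (smul V c e) (smul V (- c) e)) (add V s i)"
          unfolding s'_def i'_def using sC ceC i(1) by (simp add: add_ac closed)
        also have "\<dots> = x" using e(1) sC i(1) xs by (simp add: add_smul_cancel add_zer closed)
        finally show ?thesis using s'S i'C i'0 by metis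
      qed
      then show ?thesis using F e(1) by (intro exI[of _ "insert e F"]) auto
    qed
  qed
qed

section \<open>Restricted duals\<close>

text \<open>The annihilating ideal is the largest one inside the kernel of \<open>f\<close>; it contains the
  joint kernel of the middle factors.\<close>

lemma rdual_carr_if_finite_rank:
  assumes H: "algebra H" and f: "lin_form H f" "\<And>x. x \<notin> carr H \<Longrightarrow> f x = 0"
    and h: "\<And>g h k. (g, h, k) \<in> set ts \<Longrightarrow> lin_form H h"
    and fr: "\<And>x y z. x \<in> carr H \<Longrightarrow> y \<in> carr H \<Longrightarrow> z \<in> carr H \<Longrightarrow>
      f (mul H x (mul H y z)) = (\<Sum>(g, h, k)\<leftarrow>ts. g x * h y * k z)"
  shows "f \<in> rdual_carr H"
proof -
  have V: "vs H" using H by (simp add: algebra_def)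
  define I where "I = {y \<in> carr H. \<forall>x\<in>carr H. \<forall>z\<in>carr H. f (mul H x (mul H y z)) = 0}"
  have cl: "\<And>x y. x \<in> carr H \<Longrightarrow> y \<in> carr H \<Longrightarrow> mul H x y \<in> carr H"
    and as: "\<And>x y z. x \<in> carr H \<Longrightarrow> y \<in> carr H \<Longrightarrow> z \<in> carr H \<Longrightarrow> mul H (mul H x y) z = mul H x (mul H y z)"
    and one: "one H \<in> carr H" "\<And>x. x \<in> carr H \<Longrightarrow> mul H (one H) x = x"
      "\<And>x. x \<in> carr H \<Longrightarrow> mul H x (one H) = x"
    using H by (auto simp: algebra_def)
  have lin: "lin_form H (\<lambda>y. f (mul H x (mul H y z)))" if "x \<in> carr H" "z \<in> carr H" for x z
    using H f(1) that by (simp add: lin_form_def algebra_def vs_def)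
  have "ideal H I"
    unfolding ideal_def
  proof (intro conjI ballI allI)
    show "I \<subseteq> carr H" by (auto simp: I_def)
    show "zer H \<in> I"
      using lin_form_zer[OF V lin] V by (auto simp: I_def vs_closed)
    show "add H x y \<in> I" if "x \<in> I" "y \<in> I" for x y
      using lin that V unfolding I_def lin_form_def by (auto simp: vs_closed)
    show "smul H c x \<in> I" if "x \<in> I" for c x
      using lin that V unfolding I_def lin_form_def by (auto simp: vs_closed)
    show "mul H x y \<in> I" "mul H y x \<in> I" if "x \<in> I" "y \<in> carr H" for x y
    proof -
      have x: "x \<in> carr H" "\<And>p q. p \<in> carr H \<Longrightarrow> q \<in> carr H \<Longrightarrow> f (mul H p (mul H x q)) = 0"
        using that by (auto simp: I_def)
      show "mul H x y \<in> I" using x that(2) by (auto simp: I_def cl as)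
      have "f (mul H p (mul H (mul H y x) q)) = 0" if pq: "p \<in> carr H" "q \<in> carr H" for p q
        using x(2)[of "mul H p y" q] pq \<open>y \<in> carr H\<close> x(1) by (simp add: as cl)
      then show "mul H y x \<in> I" using x(1) that(2) by (auto simp: I_def cl)
    qed
  qed
  moreover have "cofinite H I"
  proof -
    define hs where "hs = map (\<lambda>(g, h, k). h) ts"
    have hs: "lin_form H h" if "h \<in> set hs" for h
      using that assms(4) by (auto simp: hs_def)
    obtain F where F: "finite F" "F \<subseteq> carr H"
      and dec: "\<forall>x\<in>carr H. \<exists>s\<in>span H F. \<exists>i\<in>carr H. (\<forall>h\<in>set hs. h i = 0) \<and> x = add H s i"
      using finite_codim_joint_kernel[OF V, of hs] hs by auto
    have "i \<in> I" if "i \<in> carr H" "\<forall>h\<in>set hs. h i = 0" for i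
    proof -
      have "h i = 0" if "(g, h, k) \<in> set ts" for g h k
        by (rule bspec[OF \<open>\<forall>h\<in>set hs. h i = 0\<close>]) (use that in \<open>force simp: hs_def\<close>)
      then have "(\<Sum>(g, h, k)\<leftarrow>ts. g x * h i * k z) = (\<Sum>t\<leftarrow>ts. 0)" for x z
        by (intro arg_cong[of _ _ sum_list] map_cong) auto
      then show ?thesis using that(1) by (simp add: I_def fr)
    qed
    then have "\<forall>x\<in>carr H. \<exists>s\<in>span H F. \<exists>i\<in>I. x = add H s i" using dec by meson
    then show ?thesis unfolding cofinite_def using F by (intro exI[of _ F]) auto
  qed
  moreover have "f x = 0" if "x \<in> I" for x
  proof -
    have "f (mul H (one H) (mul H x (one H))) = 0" using that one(1) by (simp add: I_def)
    then show ?thesis using that by (simp add: I_def one)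
  qed
  ultimately show ?thesis using f by (auto simp: rdual_carr_def)
qed

lemma rdual_simps [simp]:
  "carr (rdual H) = rdual_carr H" "zer (rdual H) = (\<lambda>x. 0)"
  "add (rdual H) f g = (\<lambda>x. f x + g x)" "smul (rdual H) c f = (\<lambda>x. c * f x)"
  "mul (rdual H) f g = (\<lambda>x. if x \<in> carr H then sw H x (\<lambda>y z. f y * g z) else 0)"
  "one (rdual H) = (\<lambda>x. if x \<in> carr H then cou H x else 0)"
  "cou (rdual H) f = f (one H)" "ant (rdual H) f = (\<lambda>x. if x \<in> carr H then f (ant H x) else 0)"
  unfolding rdual_def sw_def by simp_all

text \<open>The coproduct of \<open>rdual H\<close> is a choice, and says something about
  \<open>f\<close> only once some representing list \<open>ys\<close> is known to exist.\<close>

lemma rdual_cop_spec: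
  assumes "set ys \<subseteq> rdual_carr H \<times> rdual_carr H"
    and "\<And>x y. x \<in> carr H \<Longrightarrow> y \<in> carr H \<Longrightarrow> f (mul H x y) = (\<Sum>(g, h)\<leftarrow>ys. g x * h y)"
  shows "set (cop (rdual H) f) \<subseteq> rdual_carr H \<times> rdual_carr H \<and>
    (\<forall>x\<in>carr H. \<forall>y\<in>carr H. f (mul H x y) = (\<Sum>(g, h)\<leftarrow>cop (rdual H) f. g x * h y))"
proof -
  let ?P = "\<lambda>xs. set xs \<subseteq> rdual_carr H \<times> rdual_carr H \<and>
    (\<forall>x\<in>carr H. \<forall>y\<in>carr H. f (mul H x y) = (\<Sum>(g, h)\<leftarrow>xs. g x * h y))"
  have "?P ys" using assms by blast
  then have "?P (SOME xs. ?P xs)" by (rule someI)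
  moreover have "(SOME xs. ?P xs) = cop (rdual H) f" by (simp add: rdual_def)
  ultimately show ?thesis by (rule subst[where P = ?P, rotated])
qed

lemma vs_rdual:
  assumes "algebra H"
  shows "vs (rdual H)"
proof -
  have V: "vs H" using assms by (simp add: algebra_def)
  interpret vspace H by unfold_locales (rule V)
  have "(\<lambda>x. 0) \<in> rdual_carr H"
  proof -
    have "ideal H (carr H)" using assms closed by (simp add: ideal_def algebra_def)
    moreover have "cofinite H (carr H)"
      unfolding cofinite_def
      using add_zer span_zer by (intro exI[of _ "{}"]) (force simp: span_empty)
    ultimately show ?thesis by (auto simp: rdual_carr_def lin_form_def)
  qed
  moreover have "(\<lambda>x. f x + g x) \<in> rdual_carr H" if fg: "f \<in> rdual_carr H" "g \<in> rdual_carr H" for f g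
  proof -
    obtain I J where IJ: "ideal H I" "cofinite H I" "\<forall>x\<in>I. f x = 0"
      "ideal H J" "cofinite H J" "\<forall>x\<in>J. g x = 0"
      using fg by (auto simp: rdual_carr_def)
    \<comment> \<open>The sum \<open>f + g\<close> is annihilated by the intersection of the two
      annihilating ideals, which is again cofinite.\<close>
    then have "ideal H (I \<inter> J)" by (auto simp: ideal_def)
    moreover have "cofinite H (I \<inter> J)" using IJ by (intro cofinite_Int ideal_subsp)
    ultimately show ?thesis using fg IJ(3,6)
      by (auto simp: rdual_carr_def lin_form_def algebra_simps intro!: exI[of _ "I \<inter> J"])
  qed
  moreover have "(\<lambda>x. c * f x) \<in> rdual_carr H" if "f \<in> rdual_carr H" for c f
    using that unfolding rdual_carr_def by (auto intro: lin_form_mult_left)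
  ultimately show ?thesis by (auto simp: vs_def algebra_simps)
qed

text \<open>Injectivity of \<open>V\<^sup>* \<otimes> W\<^sup>* \<rightarrow> (V \<otimes> W)\<^sup>*\<close>. If the head functional \<open>h\<close> does not vanish at \<open>v\<close>,
  evaluating there expresses \<open>g\<close> through the remaining first factors, so the head can be absorbed.\<close>

lemma bilin_sum_eq_zero:
  fixes \<beta> :: "('b \<Rightarrow> 'k) \<Rightarrow> ('b \<Rightarrow> 'k) \<Rightarrow> 'k::field"
  assumes V: "vs V"
    and add: "\<And>f g. add V f g = (\<lambda>x. f x + g x)" and smul: "\<And>c f. smul V c f = (\<lambda>x. c * f x)"
    and zer: "zer V = (\<lambda>x. 0)"
    and supp: "\<And>f x. f \<in> carr V \<Longrightarrow> x \<notin> D \<Longrightarrow> f x = 0"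
    and \<beta>: "bilin V V \<beta>"
    and "set xs \<subseteq> carr V \<times> carr V"
    and "\<And>u v. u \<in> D \<Longrightarrow> v \<in> D \<Longrightarrow> (\<Sum>(g, h)\<leftarrow>xs. g u * h v) = 0"
  shows "(\<Sum>(g, h)\<leftarrow>xs. \<beta> g h) = 0"
  using assms(7,8)
proof (induction "length xs" arbitrary: xs)
  case 0
  then show ?case by simp
next
  case (Suc n)
  then obtain g h ys where xs: "xs = (g, h) # ys" by (metis length_Suc_conv surj_pair)
  have gh: "g \<in> carr V" "h \<in> carr V" and ys: "set ys \<subseteq> carr V \<times> carr V"
    using Suc.prems(1) xs by auto
  have ev: "g u * h v + (\<Sum>(g, h)\<leftarrow>ys. g u * h v) = 0" if "u \<in> D" "v \<in> D" for u v
    using Suc.prems(2)[OF that] by (simp add: xs)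
  have n: "n = length ys" using Suc.hyps(2) xs by simp
  show ?case
  proof (cases "\<forall>v\<in>D. h v = 0")
    case True
    \<comment> \<open>Members of \<open>carr V\<close> are zero off \<open>D\<close>, so vanishing
      on \<open>D\<close> makes \<open>h\<close> the zero function itself.\<close>
    then have "h = zer V" using supp[OF gh(2)] zer by auto
    then have "\<beta> g h = 0" using lin_form_zer[OF V] \<beta> gh(1) by (simp add: bilin_def)
    moreover have "(\<Sum>(g, h)\<leftarrow>ys. \<beta> g h) = 0"
      using Suc.hyps(1)[OF n ys] ev True by auto
    ultimately show ?thesis by (simp add: xs)
  next
    case False
    then obtain w where w: "w \<in> D" "h w \<noteq> 0" by auto
    define c where "c k = k w / h w" for k :: "'b \<Rightarrow> 'k"
    \<comment> \<open>The pair \<open>(g, h)\<close> is spread over the rest: since \<open>g\<close>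
      is the sum of the \<open>- c q\<close> multiples of the \<open>p\<close>, the tensor of
      \<open>g\<close> and \<open>h\<close> is the sum of \<open>p\<close> tensor
      \<open>- c q\<close> times \<open>h\<close>. The new list is shorter by one and represents the
      same tensor.\<close>
    define zs where "zs = map (\<lambda>(p, q). (p, add V q (smul V (- c q) h))) ys"
    have zsC: "set zs \<subseteq> carr V \<times> carr V"
      using ys gh(2) V unfolding zs_def by (auto simp: vs_closed)
    have gu: "g u = (\<Sum>(p, q)\<leftarrow>ys. - c q * p u)" if "u \<in> D" for u
    proof -
      have "(\<Sum>(p, q)\<leftarrow>ys. - c q * p u) * h w = (\<Sum>(p, q)\<leftarrow>ys. - (p u * q w))"
        unfolding sum_list_mult_const[symmetric] using w(2)
        by (intro arg_cong[of _ _ sum_list] map_cong) (auto simp: c_def)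
      also have "\<dots> = - (\<Sum>(p, q)\<leftarrow>ys. p u * q w)"
        by (simp add: case_prod_unfold uminus_sum_list_map comp_def)
      also have "\<dots> = g u * h w" using ev[OF that w(1)] by (metis add_eq_0_iff2)
      finally show ?thesis using w(2) by simp
    qed
    have "g = vsum V (map (\<lambda>(p, q). smul V (- c q) p) ys)"
    proof
      fix u
      have "vsum V (map (\<lambda>(p, q). smul V (- c q) p) zs) u = (\<Sum>(p, q)\<leftarrow>zs. - c q * p u)" for zs
        by (induction zs) (auto simp: vsum_def add smul zer)
      moreover have "(\<Sum>(p, q)\<leftarrow>ys. - c q * p u) = g u" if "u \<notin> D"
      proof -
        have "(\<Sum>(p, q)\<leftarrow>ys. - c q * p u) = (\<Sum>t\<leftarrow>ys. 0)"
          using supp that ys by (intro arg_cong[of _ _ sum_list] map_cong) force+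
        then show ?thesis using supp[OF gh(1) that] by simp
      qed
      ultimately show "g u = vsum V (map (\<lambda>(p, q). smul V (- c q) p) ys) u"
        using gu by metis
    qed
    moreover have "set (map (\<lambda>(p, q). smul V (- c q) p) ys) \<subseteq> carr V"
      using ys V by (auto simp: vs_closed)
    ultimately have "\<beta> g h = (\<Sum>x\<leftarrow>map (\<lambda>(p, q). smul V (- c q) p) ys. \<beta> x h)"
      using lin_form_vsum[OF V, of "\<lambda>x. \<beta> x h"] \<beta> gh(2) by (metis bilin_def)
    also have "\<dots> = (\<Sum>(p, q)\<leftarrow>ys. - c q * \<beta> p h)"
      using \<beta> gh(2) ys unfolding map_map
      by (intro arg_cong[of _ _ sum_list] map_cong) (auto simp: bilin_def lin_form_def)
    finally have bg: "\<beta> g h = (\<Sum>(p, q)\<leftarrow>ys. - c q * \<beta> p h)" .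
    have "(\<Sum>(p, q)\<leftarrow>zs. \<beta> p q) = (\<Sum>(p, q)\<leftarrow>ys. - c q * \<beta> p h + \<beta> p q)"
    proof -
      have "\<beta> p (add V q (smul V (- c q) h)) = - c q * \<beta> p h + \<beta> p q" if "(p, q) \<in> set ys" for p q
      proof -
        have "p \<in> carr V" "q \<in> carr V" "smul V (- c q) h \<in> carr V"
          using that ys gh(2) V by (auto simp: vs_closed)
        then show ?thesis using \<beta> gh(2) by (simp add: bilin_def lin_form_def)
      qed
      then show ?thesis unfolding zs_def map_map
        by (intro arg_cong[of _ _ sum_list] map_cong) auto
    qed
    also have "\<dots> = (\<Sum>(g, h)\<leftarrow>xs. \<beta> g h)"
      by (simp add: xs bg case_prod_unfold flip: sum_list_addf)
    finally have "(\<Sum>(g, h)\<leftarrow>xs. \<beta> g h) = (\<Sum>(p, q)\<leftarrow>zs. \<beta> p q)" ..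
    also have "\<dots> = 0"
    proof (rule Suc.hyps(1)[OF _ zsC])
      show "n = length zs" by (simp add: zs_def n)
      fix u v assume uv: "u \<in> D" "v \<in> D"
      have "(\<Sum>(p, q)\<leftarrow>zs. p u * q v) = (\<Sum>(p, q)\<leftarrow>ys. (- c q * p u) * h v + p u * q v)"
        unfolding zs_def map_map
        by (intro arg_cong[of _ _ sum_list] map_cong) (auto simp: add smul algebra_simps)
      also have "\<dots> = (\<Sum>(p, q)\<leftarrow>ys. - c q * p u) * h v + (\<Sum>(p, q)\<leftarrow>ys. p u * q v)"
        by (simp add: case_prod_unfold flip: sum_list_addf sum_list_mult_const)
      also have "\<dots> = 0" using ev[OF uv] gu[OF uv(1)] by simp
      finally show "(\<Sum>(p, q)\<leftarrow>zs. p u * q v) = 0" .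
    qed
    finally show ?thesis .
  qed
qed

text \<open>Appending the negative of \<open>ys\<close> to \<open>xs\<close> gives a list that
  evaluates to zero everywhere, so \<open>bilin_sum_eq_zero\<close> kills it under every bilinear
  form. Coproducts in a restricted dual can thus be compared pointwise.\<close>

lemma tensor_eq_rdualI:
  assumes H: "algebra H"
    and xs: "set xs \<subseteq> rdual_carr H \<times> rdual_carr H" and ys: "set ys \<subseteq> rdual_carr H \<times> rdual_carr H"
    and eq: "\<And>u v. u \<in> carr H \<Longrightarrow> v \<in> carr H \<Longrightarrow>
      (\<Sum>(g, h)\<leftarrow>xs. g u * h v) = (\<Sum>(g, h)\<leftarrow>ys. g u * h v)"
  shows "tensor_eq (rdual H) (rdual H) xs ys"
  unfolding tensor_eq_def
proof (intro allI impI)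
  fix \<beta> assume \<beta>: "bilin (rdual H) (rdual H) \<beta>"
  define zs where "zs = xs @ map (\<lambda>(g, h). (g, smul (rdual H) (-1) h)) ys"
  have cl: "smul (rdual H) (-1) h \<in> rdual_carr H" if "h \<in> rdual_carr H" for h
    using vs_closed(3)[OF vs_rdual[OF H]] that by (simp only: rdual_simps)
  have zs: "set zs \<subseteq> carr (rdual H) \<times> carr (rdual H)"
    unfolding zs_def using xs ys cl by (fastforce simp del: rdual_simps(4))
  have "(\<Sum>(g, h)\<leftarrow>zs. \<beta> g h) = 0"
  proof (rule bilin_sum_eq_zero[OF vs_rdual[OF H] _ _ _ _ \<beta> zs])
    show "f x = 0" if "f \<in> carr (rdual H)" "x \<notin> carr H" for f x
      using that by (simp add: rdual_carr_def)
    show "(\<Sum>(g, h)\<leftarrow>zs. g u * h v) = 0" if "u \<in> carr H" "v \<in> carr H" for u v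
      using eq[OF that]
      by (simp add: zs_def case_prod_unfold comp_def flip: uminus_sum_list_map[unfolded comp_def])
  qed simp_all
  moreover have "\<beta> g (smul (rdual H) (-1) h) = - \<beta> g h" if "(g, h) \<in> set ys" for g h
  proof -
    have "g \<in> carr (rdual H)" "h \<in> carr (rdual H)" using that ys by auto
    then show ?thesis using \<beta> unfolding bilin_def lin_form_def by (metis mult_minus1)
  qed
  then have "(\<Sum>(g, h)\<leftarrow>map (\<lambda>(g, h). (g, smul (rdual H) (-1) h)) ys. \<beta> g h) = (\<Sum>(g, h)\<leftarrow>ys. - \<beta> g h)"
    unfolding map_map by (intro arg_cong[of _ _ sum_list] map_cong) auto
  moreover have "(\<Sum>(g, h)\<leftarrow>ys. - \<beta> g h) = - (\<Sum>(g, h)\<leftarrow>ys. \<beta> g h)"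
    by (simp add: case_prod_unfold uminus_sum_list_map comp_def)
  ultimately show "(\<Sum>(g, h)\<leftarrow>xs. \<beta> g h) = (\<Sum>(g, h)\<leftarrow>ys. \<beta> g h)"
    unfolding zs_def map_append sum_list_append by simp
qed

section \<open>Sweedler calculus\<close>

locale hopf_algebra =
  fixes H :: "('k::field, 'a, 'm) halg_scheme"
  assumes hopf: "hopf H"
begin

abbreviation C :: "'a set" where "C \<equiv> carr H"
abbreviation prd :: "'a \<Rightarrow> 'a \<Rightarrow> 'a" (infixl "\<odot>" 70) where "x \<odot> y \<equiv> mul H x y"
abbreviation S :: "'a \<Rightarrow> 'a" where "S \<equiv> ant H"
abbreviation eps :: "'a \<Rightarrow> 'k" where "eps \<equiv> cou H"
abbreviation unit_elt :: 'a where "unit_elt \<equiv> one H"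

lemma bialgebra: "bialgebra H" and algebra: "algebra H" and coalgebra: "coalgebra H" and vs: "vs H"
  using hopf by (simp_all add: hopf_def bialgebra_def algebra_def)

lemma ant_lin: "lin H H S"
  using hopf by (simp add: hopf_def)

lemma closed:
  "unit_elt \<in> C" "\<And>x y. x \<in> C \<Longrightarrow> y \<in> C \<Longrightarrow> x \<odot> y \<in> C" "\<And>x. x \<in> C \<Longrightarrow> S x \<in> C"
  using algebra ant_lin by (simp_all add: algebra_def lin_def)

lemma mul_assoc: "x \<in> C \<Longrightarrow> y \<in> C \<Longrightarrow> z \<in> C \<Longrightarrow> x \<odot> y \<odot> z = x \<odot> (y \<odot> z)"
  using algebra by (simp add: algebra_def)

lemma mul_unit: "x \<in> C \<Longrightarrow> unit_elt \<odot> x = x" "x \<in> C \<Longrightarrow> x \<odot> unit_elt = x"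
  using algebra by (simp_all add: algebra_def)

lemma cop_closed: "a \<in> C \<Longrightarrow> (x, y) \<in> set (cop H a) \<Longrightarrow> x \<in> C \<and> y \<in> C"
  using coalgebra unfolding coalgebra_def by blast

lemma sw_cong:
  assumes "a \<in> C" "\<And>x y. x \<in> C \<Longrightarrow> y \<in> C \<Longrightarrow> F x y = G x y"
  shows "sw H a F = sw H a G"
  unfolding sw_def using assms cop_closed[OF assms(1)]
  by (intro arg_cong[of _ _ sum_list] map_cong) auto

lemma lin_mul_left: "lin V H g \<Longrightarrow> a \<in> C \<Longrightarrow> lin V H (\<lambda>x. a \<odot> g x)"
  and lin_mul_right: "lin V H g \<Longrightarrow> a \<in> C \<Longrightarrow> lin V H (\<lambda>x. g x \<odot> a)"
  and lin_ant: "lin V H g \<Longrightarrow> lin V H (\<lambda>x. S (g x))"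
  using algebra ant_lin by (simp_all add: lin_def algebra_def)

lemma lin_form_sw_inner:
  assumes "a \<in> C" "\<And>u v. u \<in> C \<Longrightarrow> v \<in> C \<Longrightarrow> lin_form V (\<lambda>x. F u v x)"
  shows "lin_form V (\<lambda>x. sw H a (\<lambda>u v. F u v x))"
  unfolding sw_def case_prod_unfold
  using assms cop_closed[OF assms(1)] by (intro lin_form_sum_list) auto

text \<open>The coproduct, being a list, is linear only modulo \<open>tensor_eq\<close>. Testing
  with a bilinear \<open>F\<close> turns this into honest linearity.\<close>

lemma lin_form_sw_outer:
  assumes F: "bilin H H F" and g: "lin V H g"
  shows "lin_form V (\<lambda>x. sw H (g x) F)"
proof -
  have "sw H (add H a b) F = sw H a F + sw H b F" if "a \<in> C" "b \<in> C" for a b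
    using coalgebra F that by (simp add: coalgebra_def tensor_eq_def sw_def)
  moreover have "sw H (smul H c a) F = c * sw H a F" if a: "a \<in> C" for c a
  proof -
    have "sw H (smul H c a) F = sw H a (\<lambda>x y. F (smul H c x) y)"
      using coalgebra F that by (simp add: coalgebra_def tensor_eq_def sw_def case_prod_unfold comp_def)
    also have "\<dots> = sw H a (\<lambda>x y. c * F x y)"
      using F by (intro sw_cong[OF a]) (simp add: bilin_def lin_form_def)
    finally show ?thesis by (simp add: sw_mult_left)
  qed
  ultimately show ?thesis using g by (simp add: lin_form_def lin_def)
qed

lemma eps_lin_form: "lin_form H eps"
  using coalgebra by (simp add: coalgebra_def)

text \<open>Coassociativity, counit and antipode laws all require the test expression to be
  multilinear. These rules prove such goals by following the syntax of the expression.\<close>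

lemmas multilin = bilinI trilinI lin_form_mult_left lin_form_mult_right
  lin_form_sw_inner lin_form_sw_outer lin_ident lin_mul_left lin_mul_right lin_ant closed

lemma sw_coassoc:
  assumes "a \<in> C" "trilin H \<tau>"
  shows "sw H a (\<lambda>x y. sw H x (\<lambda>u v. \<tau> u v y)) = sw H a (\<lambda>x y. sw H y (\<lambda>u v. \<tau> x u v))"
  using coalgebra assms by (simp add: coalgebra_def sw_def)

text \<open>Converts the counit and antipode axioms, which are equations in \<open>H\<close>, into
  equations between scalar Sweedler sums.\<close>

lemma lin_form_vsum_sw:
  assumes "a \<in> C" "lin_form H f" "\<And>x y. x \<in> C \<Longrightarrow> y \<in> C \<Longrightarrow> F x y \<in> C"
  shows "f (vsum H (map (\<lambda>(x, y). F x y) (cop H a))) = sw H a (\<lambda>x y. f (F x y))"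
proof -
  have "set (map (\<lambda>(x, y). F x y) (cop H a)) \<subseteq> C"
    using assms(3) cop_closed[OF assms(1)] by auto
  then show ?thesis
    using lin_form_vsum[OF vs assms(2)] by (simp add: sw_def case_prod_unfold comp_def)
qed

lemma sw_counit_left:
  assumes "a \<in> C" "lin_form H f"
  shows "sw H a (\<lambda>x y. eps x * f y) = f a"
proof -
  have "vsum H (map (\<lambda>(x, y). smul H (eps x) y) (cop H a)) = a"
    using coalgebra assms by (simp add: coalgebra_def)
  then have "f a = sw H a (\<lambda>x y. f (smul H (eps x) y))"
    using lin_form_vsum_sw[OF assms, of "\<lambda>x y. smul H (eps x) y"] vs_closed[OF vs] by simp
  also have "\<dots> = sw H a (\<lambda>x y. eps x * f y)"
    using assms by (intro sw_cong) (auto simp: lin_form_def)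
  finally show ?thesis ..
qed

lemma sw_counit_right:
  assumes "a \<in> C" "lin_form H f"
  shows "sw H a (\<lambda>x y. eps y * f x) = f a"
proof -
  have "vsum H (map (\<lambda>(x, y). smul H (eps y) x) (cop H a)) = a"
    using coalgebra assms by (simp add: coalgebra_def)
  then have "f a = sw H a (\<lambda>x y. f (smul H (eps y) x))"
    using lin_form_vsum_sw[OF assms, of "\<lambda>x y. smul H (eps y) x"] vs_closed[OF vs] by simp
  also have "\<dots> = sw H a (\<lambda>x y. eps y * f x)"
    using assms by (intro sw_cong) (auto simp: lin_form_def)
  finally show ?thesis ..
qed

lemma sw_antipode_left:
  assumes "a \<in> C" "lin_form H f"
  shows "sw H a (\<lambda>x y. f (S x \<odot> y)) = eps a * f unit_elt"
proof -
  have "vsum H (map (\<lambda>(x, y). S x \<odot> y) (cop H a)) = smul H (eps a) unit_elt"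
    using hopf assms by (simp add: hopf_def)
  then show ?thesis
    using lin_form_vsum_sw[OF assms, of "\<lambda>x y. S x \<odot> y"] assms(2) closed by (simp add: lin_form_def)
qed

lemma sw_antipode_right:
  assumes "a \<in> C" "lin_form H f"
  shows "sw H a (\<lambda>x y. f (x \<odot> S y)) = eps a * f unit_elt"
proof -
  have "vsum H (map (\<lambda>(x, y). x \<odot> S y) (cop H a)) = smul H (eps a) unit_elt"
    using hopf assms by (simp add: hopf_def)
  then show ?thesis
    using lin_form_vsum_sw[OF assms, of "\<lambda>x y. x \<odot> S y"] assms(2) closed by (simp add: lin_form_def)
qed

lemma sw_mul:
  assumes "a \<in> C" "b \<in> C" "bilin H H F"
  shows "sw H (a \<odot> b) F = sw H a (\<lambda>x y. sw H b (\<lambda>u v. F (x \<odot> u) (y \<odot> v)))"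
proof -
  have "sw H (a \<odot> b) F = sum_list (map (\<lambda>(x, y). F x y)
      (concat (map (\<lambda>(x, y). map (\<lambda>(u, v). (x \<odot> u, y \<odot> v)) (cop H b)) (cop H a))))"
    using bialgebra assms by (simp add: bialgebra_def tensor_eq_def sw_def)
  then show ?thesis
    by (simp add: map_concat comp_def case_prod_unfold sum_list_concat_map sw_def)
qed

lemma sw_unit: "bilin H H F \<Longrightarrow> sw H unit_elt F = F unit_elt unit_elt"
  using bialgebra by (simp add: bialgebra_def tensor_eq_def sw_def)

lemma eps_mul: "a \<in> C \<Longrightarrow> b \<in> C \<Longrightarrow> eps (a \<odot> b) = eps a * eps b" and eps_unit: "eps unit_elt = 1"
  using bialgebra by (simp_all add: bialgebra_def)

section \<open>The antipode as an anti-coalgebra map\<close>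

text \<open>Apply \<open>eps\<close> to the left antipode law and absorb the second factor by the
  counit law.\<close>

lemma eps_ant:
  assumes "a \<in> C"
  shows "eps (S a) = eps a"
proof -
  have "eps a = sw H a (\<lambda>x y. eps (S x \<odot> y))"
    using sw_antipode_left[OF assms eps_lin_form] by (simp add: eps_unit)
  also have "\<dots> = sw H a (\<lambda>x y. eps y * eps (S x))"
    by (intro sw_cong[OF assms]) (simp add: eps_mul closed mult.commute)
  also have "\<dots> = eps (S a)"
    by (rule sw_counit_right[OF assms lin_form_comp[OF eps_lin_form ant_lin]])
  finally show ?thesis ..
qed

text \<open>In Sweedler notation \<open>y1 S(y4)\<close> tensor \<open>y2 S(y3)\<close> collapses to
  \<open>eps y\<close> times the unit. Regrouping brings \<open>y2\<close> next to
  \<open>y3\<close>, where the antipode law cancels them; then \<open>y1\<close> and the remaining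
  factor cancel. This is the right inverse property needed for \<open>sw_ant\<close>.\<close>

lemma sw_nested_antipodes:
  assumes y: "y \<in> C" and \<gamma>: "bilin H H \<gamma>"
  shows "sw H y (\<lambda>u v. sw H u (\<lambda>s t. sw H v (\<lambda>m n. \<gamma> (s \<odot> S n) (t \<odot> S m))))
    = eps y * \<gamma> unit_elt unit_elt"
proof -
  note b = lin_form_bilin_left[OF \<gamma>] lin_form_bilin_right[OF \<gamma>]
  have "sw H y (\<lambda>u v. sw H u (\<lambda>s t. sw H v (\<lambda>m n. \<gamma> (s \<odot> S n) (t \<odot> S m))))
      = sw H y (\<lambda>s w. sw H w (\<lambda>t v. sw H v (\<lambda>m n. \<gamma> (s \<odot> S n) (t \<odot> S m))))"
    by (rule sw_coassoc[OF y]) (assumption | rule b multilin)+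
  also have "\<dots> = sw H y (\<lambda>s w. \<gamma> (s \<odot> S w) unit_elt)"
  proof (rule sw_cong[OF y])
    fix s w assume sw: "s \<in> C" "w \<in> C"
    have "sw H w (\<lambda>t v. sw H v (\<lambda>m n. \<gamma> (s \<odot> S n) (t \<odot> S m)))
        = sw H w (\<lambda>x n. sw H x (\<lambda>t m. \<gamma> (s \<odot> S n) (t \<odot> S m)))"
      by (rule sw_coassoc[OF sw(2), symmetric]) (assumption | rule sw b multilin)+
    also have "\<dots> = sw H w (\<lambda>x n. eps x * \<gamma> (s \<odot> S n) unit_elt)"
      by (intro sw_cong[OF sw(2)] sw_antipode_right)
        (assumption | rule sw b multilin)+
    also have "\<dots> = \<gamma> (s \<odot> S w) unit_elt"
      by (rule sw_counit_left[OF sw(2)]) (assumption | rule sw b multilin)+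
    finally show "sw H w (\<lambda>t v. sw H v (\<lambda>m n. \<gamma> (s \<odot> S n) (t \<odot> S m))) = \<gamma> (s \<odot> S w) unit_elt" .
  qed
  also have "\<dots> = eps y * \<gamma> unit_elt unit_elt"
    by (rule sw_antipode_right[OF y]) (assumption | rule b multilin)+
  finally show ?thesis .
qed

text \<open>The antipode reverses coproducts: \<open>\<Delta> \<circ> S\<close> is a left and \<open>(S \<otimes> S) \<circ> flip \<circ> \<Delta>\<close> a right
  convolution inverse of \<open>\<Delta>\<close>, and \<open>T\<close> below is the triple convolution product.\<close>

lemma sw_ant:
  assumes a: "a \<in> C" and \<beta>: "bilin H H \<beta>"
  shows "sw H (S a) \<beta> = sw H a (\<lambda>x y. \<beta> (S y) (S x))"
proof -
  note b = lin_form_bilin_left[OF \<beta>] lin_form_bilin_right[OF \<beta>]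
  define T where "T x u v = sw H (S x) (\<lambda>p q. sw H u (\<lambda>s t. sw H v (\<lambda>m n.
    \<beta> (p \<odot> (s \<odot> S n)) (q \<odot> (t \<odot> S m)))))" for x u v
  have T: "trilin H T"
    unfolding T_def by (assumption | rule b multilin)+
  \<comment> \<open>Grouping the last two factors of \<open>T\<close> cancels them and leaves the
    coproduct of \<open>S x\<close>.\<close>
  have "sw H y (\<lambda>u v. T x u v) = eps y * sw H (S x) \<beta>" if xy: "x \<in> C" "y \<in> C" for x y
  proof -
    have "sw H y (\<lambda>u v. T x u v) = sw H (S x) (\<lambda>p q. sw H y (\<lambda>u v. sw H u (\<lambda>s t. sw H v (\<lambda>m n.
        \<beta> (p \<odot> (s \<odot> S n)) (q \<odot> (t \<odot> S m))))))"
      unfolding T_def by (rule sw_swap)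
    also have "\<dots> = sw H (S x) (\<lambda>p q. eps y * \<beta> (p \<odot> unit_elt) (q \<odot> unit_elt))"
      by (intro sw_cong sw_nested_antipodes[where \<gamma> = "\<lambda>s t. \<beta> (_ \<odot> s) (_ \<odot> t)"])
        (assumption | rule xy b multilin)+
    also have "\<dots> = sw H (S x) (\<lambda>p q. eps y * \<beta> p q)"
      using xy by (intro sw_cong) (auto simp: closed mul_unit)
    finally show ?thesis by (simp add: sw_mult_left)
  qed
  then have "sw H a (\<lambda>x y. sw H y (\<lambda>u v. T x u v)) = sw H a (\<lambda>x y. eps y * sw H (S x) \<beta>)"
    by (intro sw_cong a)
  also have "\<dots> = sw H (S a) \<beta>"
    by (rule sw_counit_right[OF a]) (assumption | rule \<beta> b multilin)+
  finally have 1: "sw H a (\<lambda>x y. sw H y (\<lambda>u v. T x u v)) = sw H (S a) \<beta>" .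
  have "sw H x (\<lambda>u v. T u v y) = eps x * sw H y (\<lambda>m n. \<beta> (S n) (S m))"
    if xy: "x \<in> C" "y \<in> C" for x y
  proof -
    \<comment> \<open>\<open>G\<close> freezes the third factor of \<open>T\<close>. By
      multiplicativity of the coproduct the first two factors become the coproduct of
      \<open>S u \<odot> v\<close>, which the antipode law removes, leaving the flipped
      form.\<close>
    define G where "G p q = sw H y (\<lambda>m n. \<beta> (p \<odot> S n) (q \<odot> S m))" for p q
    have G: "bilin H H G" unfolding G_def by (assumption | rule xy b multilin)+
    have "sw H x (\<lambda>u v. T u v y) = sw H x (\<lambda>u v. sw H (S u \<odot> v) G)"
    proof (rule sw_cong[OF xy(1)])
      fix u v assume uv: "u \<in> C" "v \<in> C"
      have "sw H (S u \<odot> v) G = sw H (S u) (\<lambda>p q. sw H v (\<lambda>s t. G (p \<odot> s) (q \<odot> t)))"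
        using uv by (intro sw_mul G closed)
      also have "\<dots> = T u v y"
        unfolding T_def G_def using uv xy
        by (intro sw_cong) (auto simp: closed mul_assoc)
      finally show "T u v y = sw H (S u \<odot> v) G" ..
    qed
    also have "\<dots> = eps x * sw H unit_elt G"
      by (rule sw_antipode_left[OF xy(1)]) (assumption | rule G multilin)+
    also have "sw H unit_elt G = sw H y (\<lambda>m n. \<beta> (S n) (S m))"
      unfolding sw_unit[OF G] G_def using xy by (intro sw_cong) (auto simp: closed mul_unit)
    finally show ?thesis .
  qed
  then have "sw H a (\<lambda>x y. sw H x (\<lambda>u v. T u v y))
      = sw H a (\<lambda>x y. eps x * sw H y (\<lambda>m n. \<beta> (S n) (S m)))"
    by (intro sw_cong a)
  also have "\<dots> = sw H a (\<lambda>m n. \<beta> (S n) (S m))"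
    by (rule sw_counit_left[OF a]) (assumption | rule b multilin)+
  finally show ?thesis using 1 sw_coassoc[OF a T] by simp
qed

text \<open>An idempotent \<open>e\<close> with a right inverse \<open>e'\<close> is the unit:
  \<open>e = e * (e * e') = (e * e) * e' = e * e' = eps\<close> in the convolution algebra.\<close>

lemma convolution_idempotent_eq_eps:
  assumes e: "lin_form H e" "lin_form H e'"
    and idem: "\<And>c. c \<in> C \<Longrightarrow> e c = sw H c (\<lambda>x y. e x * e y)"
    and inv: "\<And>c. c \<in> C \<Longrightarrow> sw H c (\<lambda>x y. e x * e' y) = eps c"
    and c: "c \<in> C"
  shows "e c = eps c"
proof -
  have "e c = sw H c (\<lambda>x y. eps y * e x)" using sw_counit_right[OF c e(1)] ..
  also have "\<dots> = sw H c (\<lambda>x y. sw H y (\<lambda>u v. e x * e u * e' v))"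
  proof (rule sw_cong[OF c])
    fix x y assume "y \<in> C"
    then show "eps y * e x = sw H y (\<lambda>u v. e x * e u * e' v)"
      using inv by (simp add: mult.assoc sw_mult_left)
  qed
  also have "\<dots> = sw H c (\<lambda>x y. sw H x (\<lambda>u v. e u * e v * e' y))"
    by (rule sw_coassoc[OF c, symmetric]) (rule trilinI lin_form_mult_left lin_form_mult_right e)+
  also have "\<dots> = sw H c (\<lambda>x y. e x * e' y)"
    using idem by (intro sw_cong[OF c]) (simp add: sw_mult_right)
  finally show ?thesis using inv[OF c] by simp
qed

text \<open>If products in \<open>K\<close> are evaluated through the coproduct of \<open>H\<close>,
  then a second comultiplication gives a finite sum for \<open>f\<close> on triple products. The
  lemma serves both \<open>lp\<close>, with \<open>K = H\<close> and \<open>g = r\<close>, and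
  \<open>phi\<close>, with \<open>g\<close> the evaluation.\<close>

lemma rdual_carr_if_sweedler:
  assumes K: "algebra K" and a: "a \<in> C"
    and g: "\<And>p. p \<in> C \<Longrightarrow> lin_form K (g p)"
    and f: "\<And>x. x \<notin> carr K \<Longrightarrow> f x = 0" "\<And>x. x \<in> carr K \<Longrightarrow> f x = g a x"
    and mul: "\<And>p x y. p \<in> C \<Longrightarrow> x \<in> carr K \<Longrightarrow> y \<in> carr K \<Longrightarrow>
      g p (mul K x y) = sw H p (\<lambda>s t. g s x * g t y)"
  shows "f \<in> rdual_carr K"
proof (rule rdual_carr_if_finite_rank[OF K])
  have Kc: "\<And>x y. x \<in> carr K \<Longrightarrow> y \<in> carr K \<Longrightarrow> mul K x y \<in> carr K" "vs K"
    using K by (simp_all add: algebra_def)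
  show "lin_form K f"
    using g[OF a] f(2) vs_closed[OF Kc(2)] by (simp add: lin_form_def)
  show "f x = 0" if "x \<notin> carr K" for x using f(1) that .
  \<comment> \<open>The triples come from \<open>a1\<close>, \<open>a2\<close>, \<open>a3\<close>,
    obtained by comultiplying \<open>a\<close> and then its right factor.\<close>
  let ?ts = "concat (map (\<lambda>(s, t). map (\<lambda>(u, v). (g s, g u, g v)) (cop H t)) (cop H a))"
  show "lin_form K h" if ts: "(g', h, k) \<in> set ?ts" for g' h k
  proof -
    obtain s t u v where st: "(s, t) \<in> set (cop H a)" "(u, v) \<in> set (cop H t)" "h = g u"
      using ts by auto
    then have "u \<in> C" using cop_closed a by blast
    then show ?thesis using g st(3) by simp
  qed
  fix x y z assume xyz: "x \<in> carr K" "y \<in> carr K" "z \<in> carr K"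
  then have "f (mul K x (mul K y z)) = sw H a (\<lambda>s t. g s x * g t (mul K y z))"
    using f(2) mul a Kc by simp
  also have "\<dots> = sw H a (\<lambda>s t. sw H t (\<lambda>u v. g s x * g u y * g v z))"
    using xyz by (intro sw_cong[OF a]) (simp add: mul mult.assoc sw_mult_left)
  finally show "f (mul K x (mul K y z)) = (\<Sum>(g, h, k)\<leftarrow>?ts. g x * h y * k z)"
    by (simp add: sw_def map_concat comp_def case_prod_unfold sum_list_concat_map)
qed

end

section \<open>Braidings\<close>

locale braided_hopf_algebra = hopf_algebra +
  fixes r :: "'b \<Rightarrow> 'b \<Rightarrow> 'a"
  assumes braiding: "is_braiding H r"
begin

lemma r_bilin: "bilin H H r"
  using braiding by (simp add: is_braiding_def)

lemmas r_lin = lin_form_bilin_left[OF r_bilin] lin_form_bilin_right[OF r_bilin]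

lemma r_mul_right: "a \<in> C \<Longrightarrow> b \<in> C \<Longrightarrow> c \<in> C \<Longrightarrow> r a (b \<odot> c) = sw H a (\<lambda>x y. r x b * r y c)"
  using braiding unfolding is_braiding_def sw_def by blast

lemma r_mul_left: "a \<in> C \<Longrightarrow> b \<in> C \<Longrightarrow> c \<in> C \<Longrightarrow> r (a \<odot> b) c = sw H c (\<lambda>u v. r b u * r a v)"
  using braiding unfolding is_braiding_def sw_def by blast

lemma r_invertible:
  obtains r' where "bilin H H r'"
    "\<forall>a\<in>C. \<forall>b\<in>C. sw H a (\<lambda>x y. sw H b (\<lambda>u v. r x u * r' y v)) = eps a * eps b"
  using braiding unfolding is_braiding_def sw_sw_eq_concat by blast

text \<open>Pairing with the unit is convolution idempotent because the unit is idempotent in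
  \<open>H\<close>, and invertible because the unit is grouplike and \<open>r\<close> has a
  convolution inverse \<open>r'\<close>.\<close>

lemma r_unit_right:
  assumes "c \<in> C"
  shows "r c unit_elt = eps c"
proof -
  obtain r' where r': "bilin H H r'"
    "\<forall>a\<in>C. \<forall>b\<in>C. sw H a (\<lambda>x y. sw H b (\<lambda>u v. r x u * r' y v)) = eps a * eps b"
    by (rule r_invertible)
  note b = lin_form_bilin_left[OF r'(1)] lin_form_bilin_right[OF r'(1)]
  show ?thesis
  proof (rule convolution_idempotent_eq_eps[where e = "\<lambda>x. r x unit_elt" and e' = "\<lambda>x. r' x unit_elt"])
    show "lin_form H (\<lambda>x. r x unit_elt)" "lin_form H (\<lambda>x. r' x unit_elt)"
      by (rule r_lin b lin_ident closed)+
    show "r d unit_elt = sw H d (\<lambda>x y. r x unit_elt * r y unit_elt)" if "d \<in> C" for d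
      using r_mul_right[OF that closed(1) closed(1)] closed by (simp add: mul_unit)
    show "sw H d (\<lambda>x y. r x unit_elt * r' y unit_elt) = eps d" if d: "d \<in> C" for d
    proof -
      have "sw H d (\<lambda>x y. r x unit_elt * r' y unit_elt)
          = sw H d (\<lambda>x y. sw H unit_elt (\<lambda>u v. r x u * r' y v))"
        by (intro sw_cong[OF d] sw_unit[symmetric]) (assumption | rule r_lin b multilin)+
      then show ?thesis using r'(2) d closed(1) by (simp add: eps_unit)
    qed
  qed (rule assms)
qed

lemma r_unit_left:
  assumes "c \<in> C"
  shows "r unit_elt c = eps c"
proof -
  obtain r' where r': "bilin H H r'"
    "\<forall>a\<in>C. \<forall>b\<in>C. sw H a (\<lambda>x y. sw H b (\<lambda>u v. r x u * r' y v)) = eps a * eps b"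
    by (rule r_invertible)
  note b = lin_form_bilin_left[OF r'(1)] lin_form_bilin_right[OF r'(1)]
  show ?thesis
  proof (rule convolution_idempotent_eq_eps[where e = "\<lambda>x. r unit_elt x" and e' = "\<lambda>x. r' unit_elt x"])
    show "lin_form H (\<lambda>x. r unit_elt x)" "lin_form H (\<lambda>x. r' unit_elt x)"
      by (rule r_lin b lin_ident closed)+
    show "r unit_elt d = sw H d (\<lambda>x y. r unit_elt x * r unit_elt y)" if "d \<in> C" for d
      using r_mul_left[OF closed(1) closed(1) that] closed by (simp add: mul_unit)
    show "sw H d (\<lambda>x y. r unit_elt x * r' unit_elt y) = eps d" if d: "d \<in> C" for d
    proof -
      have "sw H unit_elt (\<lambda>u v. sw H d (\<lambda>x y. r u x * r' v y))
          = sw H d (\<lambda>x y. r unit_elt x * r' unit_elt y)"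
        by (rule sw_unit) (assumption | rule d r_lin b multilin)+
      then show ?thesis using r'(2) d closed(1) by (simp add: eps_unit)
    qed
  qed (rule assms)
qed

text \<open>Multiplicativity in the second argument gathers the sum into the pairing of
  \<open>c\<close> with \<open>p \<odot> S q\<close>, to which the antipode law applies.\<close>

lemma r_inverse:
  assumes "c \<in> C" "a \<in> C"
  shows "sw H c (\<lambda>x y. sw H a (\<lambda>p q. r x p * r y (S q))) = eps c * eps a"
proof -
  have "sw H c (\<lambda>x y. sw H a (\<lambda>p q. r x p * r y (S q)))
      = sw H a (\<lambda>p q. sw H c (\<lambda>x y. r x p * r y (S q)))"
    by (rule sw_swap)
  also have "\<dots> = sw H a (\<lambda>p q. r c (p \<odot> S q))"
    using assms by (intro sw_cong[OF assms(2)]) (simp add: r_mul_right closed)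
  also have "\<dots> = eps a * r c unit_elt"
    by (rule sw_antipode_right) (assumption | rule assms r_lin multilin)+
  finally show ?thesis using assms by (simp add: r_unit_right mult.commute)
qed

text \<open>Multiplicativity in the first argument reverses the order of the factors of the second
  one, and \<open>sw_ant\<close> reverses it back. The sum becomes the pairing of
  \<open>x \<odot> S y\<close> with \<open>S a\<close>.\<close>

lemma r_inverse_inverse:
  assumes "c \<in> C" "a \<in> C"
  shows "sw H c (\<lambda>x y. sw H a (\<lambda>p q. r x (S p) * r (S y) (S q))) = eps c * eps a"
proof -
  have "sw H a (\<lambda>p q. r x (S p) * r (S y) (S q)) = r (x \<odot> S y) (S a)" if "x \<in> C" "y \<in> C" for x y
  proof -
    have "r (x \<odot> S y) (S a) = sw H (S a) (\<lambda>u v. r (S y) u * r x v)"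
      using that assms by (intro r_mul_left closed)
    also have "\<dots> = sw H a (\<lambda>p q. r (S y) (S q) * r x (S p))"
      by (rule sw_ant) (assumption | rule that assms r_lin multilin)+
    finally show ?thesis by (simp add: mult.commute)
  qed
  then have "sw H c (\<lambda>x y. sw H a (\<lambda>p q. r x (S p) * r (S y) (S q)))
      = sw H c (\<lambda>x y. r (x \<odot> S y) (S a))"
    by (intro sw_cong assms)
  also have "\<dots> = eps c * r unit_elt (S a)"
    by (rule sw_antipode_right) (assumption | rule assms r_lin multilin)+
  finally show ?thesis using assms by (simp add: r_unit_left eps_ant closed)
qed

text \<open>A left and a right inverse of one element of the convolution algebra on \<open>H\<close>
  tensor \<open>H\<close> coincide. The identity turns the antipode in the definition of
  \<open>lm\<close> into plain evaluation in \<open>phi_lm\<close>.\<close>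

lemma r_ant_ant:
  assumes c: "c \<in> C" and a: "a \<in> C"
  shows "r (S c) (S a) = r c a"
proof -
  \<comment> \<open>The triple convolution product of \<open>r\<close>, its inverse and the inverse
    of that, with \<open>a\<close> comultiplied and the three parts of \<open>c\<close> left as
    arguments.\<close>
  define \<tau> where "\<tau> x u v = sw H a (\<lambda>p q. sw H q (\<lambda>m n. r x p * r u (S m) * r (S v) (S n)))"
    for x u v
  have \<tau>: "trilin H \<tau>"
    unfolding \<tau>_def by (assumption | rule a r_lin multilin)+
  have "sw H y (\<lambda>u v. \<tau> x u v) = eps y * r x a" if xy: "x \<in> C" "y \<in> C" for x y
  proof -
    have "sw H y (\<lambda>u v. \<tau> x u v)
        = sw H a (\<lambda>p q. sw H y (\<lambda>u v. sw H q (\<lambda>m n. r x p * r u (S m) * r (S v) (S n))))"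
      unfolding \<tau>_def by (rule sw_swap)
    also have "\<dots> = sw H a (\<lambda>p q. eps y * (eps q * r x p))"
    proof (rule sw_cong[OF a])
      fix p q assume "q \<in> C"
      then show "sw H y (\<lambda>u v. sw H q (\<lambda>m n. r x p * r u (S m) * r (S v) (S n)))
          = eps y * (eps q * r x p)"
        using r_inverse_inverse[OF xy(2)] by (simp add: mult.assoc sw_mult_left)
    qed
    also have "\<dots> = eps y * r x a"
      unfolding sw_mult_left using sw_counit_right[OF a, of "r x"] r_bilin xy(1)
      by (simp add: bilin_def)
    finally show ?thesis .
  qed
  then have "sw H c (\<lambda>x y. sw H y (\<lambda>u v. \<tau> x u v)) = sw H c (\<lambda>x y. eps y * r x a)"
    by (intro sw_cong c)
  also have "\<dots> = r c a"
    by (rule sw_counit_right) (assumption | rule a c r_lin multilin)+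
  finally have 1: "sw H c (\<lambda>x y. sw H y (\<lambda>u v. \<tau> x u v)) = r c a" .
  have "sw H x (\<lambda>u v. \<tau> u v y) = eps x * r (S y) (S a)" if xy: "x \<in> C" "y \<in> C" for x y
  proof -
    \<comment> \<open>The argument \<open>a\<close> must be regrouped too before the first two
      factors can cancel by \<open>r_inverse\<close>.\<close>
    have "\<tau> u v y = sw H a (\<lambda>p q. sw H p (\<lambda>m n. r u m * r v (S n) * r (S y) (S q)))"
      if uv: "u \<in> C" "v \<in> C" for u v
      unfolding \<tau>_def
      by (rule sw_coassoc[OF a, symmetric]) (assumption | rule uv xy r_lin multilin)+
    then have "sw H x (\<lambda>u v. \<tau> u v y)
        = sw H x (\<lambda>u v. sw H a (\<lambda>p q. sw H p (\<lambda>m n. r u m * r v (S n) * r (S y) (S q))))"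
      by (intro sw_cong xy)
    also have "\<dots> = sw H a (\<lambda>p q. sw H x (\<lambda>u v. sw H p (\<lambda>m n. r u m * r v (S n) * r (S y) (S q))))"
      by (rule sw_swap)
    also have "\<dots> = sw H a (\<lambda>p q. eps x * (eps p * r (S y) (S q)))"
      using r_inverse[OF xy(1)] by (intro sw_cong[OF a]) (simp add: sw_mult_right)
    also have "\<dots> = eps x * r (S y) (S a)"
      unfolding sw_mult_left
      by (rule arg_cong[of _ _ "\<lambda>z. eps x * z"], rule sw_counit_left[OF a])
        (assumption | rule xy r_lin multilin)+
    finally show ?thesis .
  qed
  then have "sw H c (\<lambda>x y. sw H x (\<lambda>u v. \<tau> u v y)) = sw H c (\<lambda>x y. eps x * r (S y) (S a))"
    by (intro sw_cong c)
  also have "\<dots> = r (S c) (S a)"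
    by (rule sw_counit_left) (assumption | rule a c r_lin multilin)+
  finally show ?thesis using 1 sw_coassoc[OF c \<tau>] by simp
qed

section \<open>The map \<open>lp\<close> into the restricted dual\<close>

lemma lp_in_rdual:
  assumes "a \<in> C"
  shows "lp H r a \<in> rdual_carr H"
proof (rule rdual_carr_if_sweedler[OF algebra assms, of r])
  show "lin_form H (r p)" if "p \<in> C" for p using r_bilin that by (simp add: bilin_def)
qed (auto simp: lp_def r_mul_right)

text \<open>The images under \<open>lp\<close> of the two legs of \<open>cop H a\<close> form a
  representing list, which pins down the evaluations of the chosen coproduct. It covers all of
  \<open>U0\<close>, whose members are values of \<open>lp\<close>.\<close>

lemma cop_rdual_lp:
  assumes a: "a \<in> C" and "b \<in> C" "c \<in> C"
  shows "(\<Sum>(g, h)\<leftarrow>cop (rdual H) (lp H r a). g b * h c) = lp H r a (b \<odot> c)"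
proof -
  let ?ys = "map (\<lambda>(s, t). (lp H r s, lp H r t)) (cop H a)"
  have "set ?ys \<subseteq> rdual_carr H \<times> rdual_carr H"
    using cop_closed[OF a] lp_in_rdual by auto
  moreover have "lp H r a (x \<odot> y) = (\<Sum>(g, h)\<leftarrow>?ys. g x * h y)" if "x \<in> C" "y \<in> C" for x y
    using that a by (simp add: lp_def closed r_mul_right sw_def comp_def case_prod_unfold)
  ultimately show ?thesis using rdual_cop_spec[of ?ys H "lp H r a"] assms by simp
qed

end

section \<open>Hopf subalgebras of \<open>U\<^sub>0\<close>\<close>

locale sub_hopf_U0 = braided_hopf_algebra H r
  for H :: "('k::field, 'a, 'm) halg_scheme" and r :: "'a \<Rightarrow> 'a \<Rightarrow> 'k" +
  fixes B :: "('a \<Rightarrow> 'k) set"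
  assumes sub: "sub_hopf (rdual H) B" and B_U0: "B \<subseteq> U0 H r"
begin

abbreviation K :: "('k, 'a \<Rightarrow> 'k) halg" where "K \<equiv> subhalg (rdual H) B"

lemma K_simps [simp]:
  "carr K = B" "zer K = (\<lambda>x. 0)" "add K f g = (\<lambda>x. f x + g x)" "smul K c f = (\<lambda>x. c * f x)"
  "mul K f g = (\<lambda>x. if x \<in> C then sw H x (\<lambda>y z. f y * g z) else 0)"
  "one K = (\<lambda>x. if x \<in> C then eps x else 0)"
  "cou K f = f unit_elt" "ant K f = (\<lambda>x. if x \<in> C then f (S x) else 0)"
  by (simp_all add: subhalg_def)

lemma B_closed:
  "zer K \<in> B" "one K \<in> B" "\<And>u v. u \<in> B \<Longrightarrow> v \<in> B \<Longrightarrow> add K u v \<in> B"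
  "\<And>u v. u \<in> B \<Longrightarrow> v \<in> B \<Longrightarrow> mul K u v \<in> B" "\<And>c u. u \<in> B \<Longrightarrow> smul K c u \<in> B"
  "\<And>u. u \<in> B \<Longrightarrow> ant K u \<in> B"
  using sub by (simp_all add: sub_hopf_def)

lemma B_lin_form: "u \<in> B \<Longrightarrow> lin_form H u"
  and B_off: "u \<in> B \<Longrightarrow> x \<notin> C \<Longrightarrow> u x = 0"
  using sub by (auto simp: sub_hopf_def rdual_carr_def)

section \<open>The algebra and the coproduct of \<open>B\<close>\<close>

lemma vs_K: "vs K"
  using B_closed(1,3,5) by (auto simp: vs_def algebra_simps)

text \<open>The product on \<open>B\<close> is convolution of functionals: associativity is
  coassociativity of \<open>H\<close> tested on \<open>u\<close>, \<open>v\<close>,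
  \<open>w\<close>, and the unit laws are the counit laws of \<open>H\<close>.\<close>

lemma algebra_K: "algebra K"
proof -
  have add: "sw H x (\<lambda>y z. (u y + v y) * w z) = sw H x (\<lambda>y z. u y * w z) + sw H x (\<lambda>y z. v y * w z)"
    "sw H x (\<lambda>y z. w y * (u z + v z)) = sw H x (\<lambda>y z. w y * u z) + sw H x (\<lambda>y z. w y * v z)"
    for u v w and x
    by (simp_all add: sw_def case_prod_unfold algebra_simps sum_list_addf)
  have smul: "sw H x (\<lambda>y z. c * u y * w z) = c * sw H x (\<lambda>y z. u y * w z)"
    "sw H x (\<lambda>y z. w y * (c * u z)) = c * sw H x (\<lambda>y z. w y * u z)" for u w c x
    by (simp_all add: sw_mult_left[symmetric] mult_ac)
  have assoc: "mul K (mul K u v) w = mul K u (mul K v w)" if B: "u \<in> B" "v \<in> B" "w \<in> B" for u v w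
  proof
    fix x
    show "mul K (mul K u v) w x = mul K u (mul K v w) x"
    proof (cases "x \<in> C")
      case x: True
      have "mul K (mul K u v) w x = sw H x (\<lambda>y z. sw H y (\<lambda>s t. u s * v t * w z))"
        using x by (auto simp: sw_mult_right intro!: sw_cong)
      also have "\<dots> = sw H x (\<lambda>y z. sw H z (\<lambda>s t. u y * v s * w t))"
        by (rule sw_coassoc[OF x])
          (rule trilinI lin_form_mult_left lin_form_mult_right B_lin_form B)+
      also have "\<dots> = mul K u (mul K v w) x"
        using x by (auto simp: sw_mult_left mult.assoc intro!: sw_cong)
      finally show ?thesis .
    qed simp
  qed
  have one: "mul K (one K) u = u" "mul K u (one K) = u" if u: "u \<in> B" for u
  proof -
    have "mul K (one K) u x = u x" "mul K u (one K) x = u x" for x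
    proof -
      have *: "sw H x (\<lambda>y z. (if y \<in> C then eps y else 0) * u z) = u x"
        "sw H x (\<lambda>y z. u y * (if z \<in> C then eps z else 0)) = u x" if x: "x \<in> C"
        using sw_counit_left[OF x B_lin_form[OF u]] sw_counit_right[OF x B_lin_form[OF u]]
          sw_cong[OF x, of "\<lambda>y z. (if y \<in> C then eps y else 0) * u z" "\<lambda>y z. eps y * u z"]
          sw_cong[OF x, of "\<lambda>y z. u y * (if z \<in> C then eps z else 0)" "\<lambda>y z. eps z * u y"]
        by (simp_all add: mult.commute)
      then show "mul K (one K) u x = u x" "mul K u (one K) x = u x"
        using B_off[OF u] by auto
    qed
    then show "mul K (one K) u = u" "mul K u (one K) = u" by auto
  qed
  show ?thesis
    unfolding algebra_def
  proof (intro conjI ballI allI)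
    show "mul K (mul K x y) z = mul K x (mul K y z)" if "x \<in> carr K" "y \<in> carr K" "z \<in> carr K" for x y z
      using assoc that by simp
    show "mul K (one K) x = x" "mul K x (one K) = x" if "x \<in> carr K" for x
      using one that by (simp_all only: K_simps(1))
    show "one K \<in> carr K" "\<And>x y. x \<in> carr K \<Longrightarrow> y \<in> carr K \<Longrightarrow> mul K x y \<in> carr K"
      using B_closed(2,4) by (simp_all only: K_simps(1))
  qed (auto simp: add smul vs_K)
qed

lemma cop_K:
  assumes "u \<in> B"
  shows "set (cop K u) \<subseteq> B \<times> B \<and> tensor_eq (rdual H) (rdual H) (cop K u) (cop (rdual H) u)"
proof -
  have "cop K u = (SOME xs. set xs \<subseteq> B \<times> B \<and> tensor_eq (rdual H) (rdual H) xs (cop (rdual H) u))"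
    by (simp add: subhalg_def)
  moreover have "\<exists>xs. set xs \<subseteq> B \<times> B \<and> tensor_eq (rdual H) (rdual H) xs (cop (rdual H) u)"
    using sub assms by (simp add: sub_hopf_def)
  ultimately show ?thesis by (metis (mono_tags, lifting) someI_ex)
qed

text \<open>Evaluation at \<open>a\<close> and \<open>b\<close> is a bilinear form, hence blind to
  which list was chosen for the coproduct in \<open>B\<close>. Writing \<open>u\<close> as a value
  of \<open>lp\<close> then makes \<open>cop_rdual_lp\<close> available.\<close>

lemma cop_K_eval:
  assumes u: "u \<in> B" and "a \<in> C" "b \<in> C"
  shows "(\<Sum>(g, h)\<leftarrow>cop K u. g a * h b) = u (a \<odot> b)"
proof -
  obtain c where c: "c \<in> C" "u = lp H r c" using u B_U0 by (auto simp: U0_def)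
  have "bilin (rdual H) (rdual H) (\<lambda>g h. g a * h b)"
    by (simp add: bilin_def lin_form_def algebra_simps)
  then have "(\<Sum>(g, h)\<leftarrow>cop K u. g a * h b) = (\<Sum>(g, h)\<leftarrow>cop (rdual H) u. g a * h b)"
    using cop_K[OF u] by (simp add: tensor_eq_def)
  also have "\<dots> = u (a \<odot> b)" using cop_rdual_lp[OF c(1) assms(2,3)] c(2) by simp
  finally show ?thesis .
qed

section \<open>\<open>phi\<close> as a Hopf algebra map\<close>

lemma phi_in_rdual:
  assumes a: "a \<in> C"
  shows "phi B a \<in> rdual_carr K"
  by (rule rdual_carr_if_sweedler[OF algebra_K a, of "\<lambda>p u. u p"])
    (simp_all add: phi_def lin_form_def)

lemma phi_mul_eval:
  assumes "a \<in> C" "u \<in> B" "v \<in> B"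
  shows "phi B a (mul K u v) = (\<Sum>(g, h)\<leftarrow>map (\<lambda>(x, y). (phi B x, phi B y)) (cop H a). g u * h v)"
  using assms B_closed(4)[OF assms(2,3)]
  by (simp add: phi_def sw_def comp_def case_prod_unfold)

text \<open>Both lists represent the same functional, the value at \<open>a\<close> of the product
  of \<open>u\<close> and \<open>v\<close>, so \<open>tensor_eq_rdualI\<close> identifies
  them.\<close>

lemma phi_cop:
  assumes a: "a \<in> C"
  shows "tensor_eq (rdual K) (rdual K) (map (\<lambda>(x, y). (phi B x, phi B y)) (cop H a)) (cop (rdual K) (phi B a))"
proof -
  let ?ys = "map (\<lambda>(x, y). (phi B x, phi B y)) (cop H a)"
  have ys: "set ?ys \<subseteq> rdual_carr K \<times> rdual_carr K"
    using cop_closed[OF a] phi_in_rdual by auto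
  have ev: "phi B a (mul K u v) = (\<Sum>(g, h)\<leftarrow>?ys. g u * h v)" if "u \<in> carr K" "v \<in> carr K" for u v
    using phi_mul_eval[OF a] that by (simp only: K_simps(1))
  note spec = rdual_cop_spec[OF ys, of "phi B a", OF ev]
  show ?thesis
  proof (rule tensor_eq_rdualI[OF algebra_K ys])
    show "set (cop (rdual K) (phi B a)) \<subseteq> rdual_carr K \<times> rdual_carr K" using spec by blast
    show "(\<Sum>(g, h)\<leftarrow>?ys. g u * h v) = (\<Sum>(g, h)\<leftarrow>cop (rdual K) (phi B a). g u * h v)"
      if "u \<in> carr K" "v \<in> carr K" for u v
      using spec ev[OF that] that by metis
  qed
qed

lemma phi_add: "a \<in> C \<Longrightarrow> b \<in> C \<Longrightarrow> phi B (add H a b) = add (rdual K) (phi B a) (phi B b)"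
  and phi_smul: "a \<in> C \<Longrightarrow> phi B (smul H c a) = smul (rdual K) c (phi B a)"
  using B_lin_form by (auto simp: phi_def lin_form_def)

lemma phi_zer: "phi B (zer H) = zer (rdual K)"
  using lin_form_zer[OF vs B_lin_form] by (auto simp: phi_def)

lemma phi_mul:
  assumes "a \<in> C" "b \<in> C"
  shows "phi B (a \<odot> b) = mul (rdual K) (phi B a) (phi B b)"
proof
  fix u
  show "phi B (a \<odot> b) u = mul (rdual K) (phi B a) (phi B b) u"
  proof (cases "u \<in> B")
    case u: True
    \<comment> \<open>\<open>phi\<close> evaluates only on \<open>B\<close> and is zero elsewhere,
      so it matters that the legs of \<open>cop K u\<close> were chosen inside
      \<open>B\<close>.\<close>
    have "sw K u (\<lambda>g h. phi B a g * phi B b h) = (\<Sum>(g, h)\<leftarrow>cop K u. g a * h b)"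
      unfolding sw_def using cop_K[OF u]
      by (intro arg_cong[of _ _ sum_list] map_cong) (auto simp: phi_def)
    then show ?thesis using u cop_K_eval[OF u assms] by (simp add: phi_def)
  qed (simp add: phi_def)
qed

lemma phi_unit: "phi B unit_elt = one (rdual K)"
  by (auto simp: phi_def)

lemma phi_cou: "a \<in> C \<Longrightarrow> cou (rdual K) (phi B a) = eps a"
  using B_closed(2) by (simp add: phi_def)

lemma phi_ant: "a \<in> C \<Longrightarrow> ant (rdual K) (phi B a) = phi B (S a)"
  using B_closed(6) by (auto simp: phi_def)

lemma phi_hopf_map: "hopf_map H (rdual K) (phi B)"
  unfolding hopf_map_def lin_def
  using phi_in_rdual phi_add phi_smul phi_mul phi_unit phi_cou phi_cop by simp

section \<open>The transported braiding and the maps \<open>lp\<close>, \<open>lm\<close> of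
  \<open>B\<close>\<close>

lemma lp_SOME:
  assumes "u \<in> B"
  shows "(SOME a. a \<in> C \<and> lp H r a = u) \<in> C \<and> lp H r (SOME a. a \<in> C \<and> lp H r a = u) = u"
  by (rule someI_ex[where P = "\<lambda>a. a \<in> C \<and> lp H r a = u"]) (use assms B_U0 in \<open>auto simp: U0_def\<close>)

lemma lm_SOME:
  assumes "u \<in> B"
  shows "(SOME a. a \<in> C \<and> lm H r a = u) \<in> C \<and> lm H r (SOME a. a \<in> C \<and> lm H r a = u) = u"
  by (rule someI_ex[where P = "\<lambda>a. a \<in> C \<and> lm H r a = u"]) (use assms B_U0 in \<open>auto simp: U0_def\<close>)

text \<open>The chosen preimage \<open>a'\<close> enters only through \<open>lp H r a'\<close>,
  which equals \<open>lp H r a\<close>, so it can be replaced by \<open>a\<close>. The pairing of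
  \<open>a\<close> with \<open>S b\<close> is then \<open>lm H r b\<close> at \<open>a\<close>, that
  is \<open>u a\<close>, whichever \<open>b\<close> was chosen.\<close>

lemma brU_lp:
  assumes a: "a \<in> C" "lp H r a \<in> B" and u: "u \<in> B"
  shows "brU H r (lp H r a) u = u a"
proof -
  define a' where "a' = (SOME c. c \<in> C \<and> lp H r c = lp H r a)"
  define b where "b = (SOME c. c \<in> C \<and> lm H r c = u)"
  have a': "a' \<in> C" "lp H r a' = lp H r a" using lp_SOME[OF a(2)] by (auto simp: a'_def)
  have b: "b \<in> C" "lm H r b = u" using lm_SOME[OF u] by (auto simp: b_def)
  have "brU H r (lp H r a) u = r a' (S b)" by (simp add: brU_def a'_def b_def)
  also have "\<dots> = lp H r a (S b)" using a'(2)[symmetric] b(1) by (simp add: lp_def closed)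
  also have "\<dots> = u a" using b a by (simp add: lp_def closed b(2)[symmetric] lm_def)
  finally show ?thesis .
qed

lemma phi_lp:
  assumes "a \<in> C" "lp H r a \<in> B"
  shows "phi B a = lp K (brU H r) (lp H r a)"
  using brU_lp[OF assms] by (auto simp: phi_def lp_def[of K])

lemma phi_lm:
  assumes a: "a \<in> C" "lm H r a \<in> B"
  shows "phi B a = lm K (brU H r) (lm H r a)"
proof
  fix u
  show "phi B a u = lm K (brU H r) (lm H r a) u"
  proof (cases "u \<in> B")
    case u: True
    obtain c where c: "c \<in> C" "u = lp H r c" using u B_U0 by (auto simp: U0_def)
    \<comment> \<open>The antipode sends \<open>lm H r a\<close> to another member of
      \<open>B\<close>, so \<open>brU_lp\<close> applies with \<open>u\<close> written as
      \<open>lp H r c\<close> and the form becomes evaluation at \<open>c\<close>.\<close>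
    have "brU H r u (ant K (lm H r a)) = ant K (lm H r a) c"
      using brU_lp[OF c(1)] u c(2) B_closed(6)[OF a(2)] by blast
    also have "\<dots> = r (S c) (S a)" using c(1) a(1) by (simp add: lm_def closed)
    also have "\<dots> = u a" using r_ant_ant[OF c(1) a(1)] a(1) c(2) by (simp add: lp_def)
    finally show ?thesis using u by (simp add: phi_def lm_def[of K])
  qed (simp add: phi_def lm_def[of K])
qed

section \<open>The image of \<open>phi\<close> contains U(B)\<close>

lemma sub_hopf_phi_image: "sub_hopf (rdual K) (phi B ` C)"
  unfolding sub_hopf_def
proof (intro conjI ballI allI)
  show "phi B ` C \<subseteq> carr (rdual K)" using phi_in_rdual by auto
  show "zer (rdual K) \<in> phi B ` C" using phi_zer vs_closed(1)[OF vs] by (metis imageI)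
  show "one (rdual K) \<in> phi B ` C" using phi_unit closed(1) by (metis imageI)
next
  fix x y assume "x \<in> phi B ` C" "y \<in> phi B ` C"
  then obtain a b where ab: "a \<in> C" "b \<in> C" "x = phi B a" "y = phi B b" by blast
  show "add (rdual K) x y \<in> phi B ` C"
    unfolding ab(3,4) phi_add[OF ab(1,2), symmetric] by (intro imageI vs_closed[OF vs] ab)
  show "mul (rdual K) x y \<in> phi B ` C"
    unfolding ab(3,4) phi_mul[OF ab(1,2), symmetric] by (intro imageI closed ab)
next
  fix c x assume "x \<in> phi B ` C"
  then obtain a where a: "a \<in> C" "x = phi B a" by blast
  show "smul (rdual K) c x \<in> phi B ` C"
    unfolding a(2) phi_smul[OF a(1), symmetric] by (intro imageI vs_closed[OF vs] a)
next
  fix x assume "x \<in> phi B ` C"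
  then obtain a where a: "a \<in> C" "x = phi B a" by blast
  show "ant (rdual K) x \<in> phi B ` C"
    unfolding a(2) phi_ant[OF a(1)] by (intro imageI closed a)
  \<comment> \<open>The coproduct of \<open>a\<close>, pushed forward along \<open>phi\<close>,
    stays in the image and represents the right tensor by \<open>phi_cop\<close>.\<close>
  show "\<exists>xs. set xs \<subseteq> phi B ` C \<times> phi B ` C \<and> tensor_eq (rdual K) (rdual K) xs (cop (rdual K) x)"
    unfolding a(2) using phi_cop[OF a(1)] cop_closed[OF a(1)]
    by (intro exI[of _ "map (\<lambda>(x, y). (phi B x, phi B y)) (cop H a)"]) auto
qed

text \<open>Each \<open>u\<close> in \<open>B\<close> has a preimage under \<open>lp H r\<close> and
  another under \<open>lm H r\<close>; \<open>phi\<close> sends them to the two generators given by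
  \<open>u\<close>. As an intersection over all Hopf subalgebras containing the generators, U(B)
  lies in the image of \<open>phi\<close>.\<close>

lemma gen_hopf_subset_phi_image:
  "gen_hopf (rdual K) (lp K (brU H r) ` B \<union> lm K (brU H r) ` B) \<subseteq> phi B ` C"
proof -
  have "lp K (brU H r) u \<in> phi B ` C" "lm K (brU H r) u \<in> phi B ` C" if u: "u \<in> B" for u
  proof -
    obtain a b where "a \<in> C" "u = lp H r a" "b \<in> C" "u = lm H r b"
      using u B_U0 unfolding U0_def by blast
    then show "lp K (brU H r) u \<in> phi B ` C" "lm K (brU H r) u \<in> phi B ` C"
      using u phi_lp phi_lm by (metis imageI)+
  qed
  then show ?thesis unfolding gen_hopf_def using sub_hopf_phi_image by blast
qed

end

theorem theorem2:
  fixes A :: "('k::field, 'a) halg" and r :: "'a \<Rightarrow> 'a \<Rightarrow> 'k" and B :: "('a \<Rightarrow> 'k) set"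
  assumes "hopf A" and "is_braiding A r"
    and "sub_hopf (rdual A) B" and "B \<subseteq> U0 A r"
    and "is_braiding (subhalg (rdual A) B) (brU A r)"
  shows "hopf_map A (rdual (subhalg (rdual A) B)) (phi B)
    \<and> (\<forall>a\<in>carr A. lp A r a \<in> B \<longrightarrow>
         phi B a = lp (subhalg (rdual A) B) (brU A r) (lp A r a))
    \<and> (\<forall>a\<in>carr A. lm A r a \<in> B \<longrightarrow>
         phi B a = lm (subhalg (rdual A) B) (brU A r) (lm A r a))
    \<and> gen_hopf (rdual (subhalg (rdual A) B))
        (lp (subhalg (rdual A) B) (brU A r) ` B \<union> lm (subhalg (rdual A) B) (brU A r) ` B)
      \<subseteq> phi B ` carr A"
proof -
  interpret sub_hopf_U0 A r B
    by unfold_locales (use assms in auto)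
  show ?thesis
    using phi_hopf_map phi_lp phi_lm gen_hopf_subset_phi_image by blast
qed

end
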